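(* Let $p\leq q$ be positive integers and $L,M,N\in\mathrm{Gr}_{p,q}$. Let $\varphi_j=\Psi_j[L,M]$, $\psi_j=\Psi_j[M,N]$, $\theta_j=\Psi_j[L,N]$ for $j=1,\dots,p$. Let $\mathcal{Z}\subset\mathbb{R}^p$ be the convex hull of the $W_p$-orbit of the vector $(\psi_1,\dots,\psi_p)$, and let $\mathcal{U}=(\varphi_1,\dots,\varphi_p)+\mathcal{Z}$. Then there exists a vector $(\theta_1^\circ,\dots,\theta_p^\circ)\in\mathcal{U}$ such that the collection of numbers $(\cos\theta_1^\circ,\dots,\cos\theta_p^\circ)$ coincides, up to a permutation, with the collection $(\cos\theta_1,\dots,\cos\theta_p)$.
   Context: $\mathrm{Gr}_{p,q}$ is the set of $p$-dimensional linear subspaces of $\mathbb{R}^{p+q}$ with the standard scalar product $\langle\cdot,\cdot\rangle$. For $L,M\in\mathrm{Gr}_{p,q}$ choose orthonormal bases $e_1,\dots,e_p$ of $L$ and $f_1,\dots,f_p$ of $M$ and let $\Lambda$ be the $p\times p$ matrix with entries $\langle e_i,f_j\rangle$; its singular values $\lambda_1\geq\dots\geq\lambda_p$ do not depend on the bases. The Jordan angles are $\Psi_j[L,M]:=\arccos\lambda_j$, so $0\leq\Psi_1[L,M]\leq\dots\leq\Psi_p[L,M]\leq\pi/2$. $W_p$ is the group of linear transformations of $\mathbb{R}^p$ generated by permutations of coordinates and sign changes $(t_1,\dots,t_p)\mapsto(\sigma_1t_1,\dots,\sigma_pt_p)$, $\sigma_j=\pm1$. *)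

theory Defs
  imports "HOL-Analysis.Analysis"
begin

text \<open>Ambient space R^(p+q) is real^'n; the index set {1..p} is the finite linearly
ordered type 'p, so p = CARD('p) and q = CARD('n) - CARD('p).\<close>

definition Gr :: "('p::finite) itself \<Rightarrow> (real^'n) set set" where
  "Gr _ = {L. subspace L \<and> dim L = CARD('p)}"

definition orthonormal_basis :: "(real^'n) set \<Rightarrow> ('p::finite \<Rightarrow> real^'n) \<Rightarrow> bool" where
  "orthonormal_basis L e \<longleftrightarrow>
     (\<forall>i j. e i \<bullet> e j = (if i = j then 1 else 0)) \<and> span (range e) = L"

definition gram :: "('p::finite \<Rightarrow> real^'n) \<Rightarrow> ('p \<Rightarrow> real^'n) \<Rightarrow> real^'p^'p" where
  "gram e f = (\<chi> i j. e i \<bullet> f j)"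

definition singular_values :: "real^('p::{finite,linorder})^('p::{finite,linorder}) \<Rightarrow> real^('p::{finite,linorder}) \<Rightarrow> bool" where
  "singular_values A s \<longleftrightarrow>
     (\<forall>i. 0 \<le> s$i) \<and> (\<forall>i j. i \<le> j \<longrightarrow> s$j \<le> s$i) \<and>
     (\<exists>U V. orthogonal_matrix U \<and> orthogonal_matrix V \<and>
        A = U ** (\<chi> i j. if i = j then s$i else 0) ** transpose V)"

definition jordan_angles ::
  "(real^'n) set \<Rightarrow> (real^'n) set \<Rightarrow> real^('p::{finite,linorder})" where
  "jordan_angles L M =
     (let s = (SOME s. \<exists>e f. orthonormal_basis L e \<and> orthonormal_basis M f \<and>
                               singular_values (gram e f) s)
      in \<chi> j. arccos (s$j))"

text \<open>Orbit of x under W_p (group generated by coordinate permutations and sign changes;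
  its elements are exactly the signed permutations t \<mapsto> (eps_i * t_(sigma i))_i).\<close>
definition Wp_orbit :: "real^'p::finite \<Rightarrow> (real^'p) set" where
  "Wp_orbit x = {(\<chi> i. \<epsilon> i * x$(\<sigma> i)) | \<sigma> \<epsilon>.
                   \<sigma> permutes (UNIV::'p set) \<and> (\<forall>i. \<epsilon> i = 1 \<or> \<epsilon> i = -1)}"

end

theory Submission
  imports Defs
begin

text \<open>The stronger fact proved here is that \<open>\<theta> - \<phi>\<close> itself lies in the convex hull \<open>Z\<close>.
  By separation it suffices to bound \<open>a \<bullet> (\<theta> - \<phi>)\<close> by the support function \<open>h a\<close> of \<open>Z\<close>.
  Join \<open>M\<close> to \<open>N\<close> by the geodesic \<open>M(t)\<close> spanned by
  \<open>m\<^sub>k(t) = cos (t \<psi>\<^sub>k) e\<^sub>k + sin (t \<psi>\<^sub>k) v\<^sub>k\<close>, and write \<open>n\<^sub>k(t)\<close> for the unit velocity of \<open>m\<^sub>k\<close>.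
  Along any sequence of times converging to \<open>t\<close>, compactness yields convergent principal vectors
  \<open>y\<^sub>j \<in> M(t)\<close> and normals \<open>w\<^sub>j \<bottom> M(t)\<close>, and the difference quotients of the \<open>j\<close>-th angle between
  \<open>L\<close> and \<open>M(t)\<close> converge to \<open>- (\<Sum>k. (y\<^sub>j \<bullet> m\<^sub>k) (n\<^sub>k \<bullet> w\<^sub>j) \<psi>\<^sub>k)\<close>.
  By Bessel's inequality the absolute values of these limits are dominated by a doubly substochastic
  matrix applied to \<open>\<psi>\<close>, so the rearrangement inequality bounds the derivative of
  \<open>a \<bullet> angles\<close> by \<open>h a\<close>.\<close>

section \<open>Orthonormal families\<close>

text \<open>Families are stored as the rows of a matrix rather than as functions, so that they form
  a subset of a Euclidean space, where compactness and limits are available.\<close>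

definition orthonormal :: "real^'n^'p \<Rightarrow> bool" where
  "orthonormal X \<longleftrightarrow> (\<forall>i j. X$i \<bullet> X$j = (if i = j then 1 else 0))"

lemma orthonormal_inner: "orthonormal X \<Longrightarrow> X$i \<bullet> X$j = (if i = j then 1 else 0)"
  by (simp add: orthonormal_def)

lemma orthonormal_norm: "orthonormal X \<Longrightarrow> norm (X$i) = 1"
  by (simp add: orthonormal_inner norm_eq_1)

lemma orthonormal_inj: "orthonormal X \<Longrightarrow> inj (\<lambda>i. X$i)"
  by (rule injI) (metis orthonormal_inner zero_neq_one)

lemma orthonormal_independent:
  fixes X :: "real^'n^'p"
  assumes "orthonormal X"
  shows "independent (range (\<lambda>i. X$i))"
proof (rule pairwise_orthogonal_independent)
  show "pairwise orthogonal (range (\<lambda>i. X$i))"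
    using assms by (auto simp: pairwise_def orthogonal_def orthonormal_def)
  show "0 \<notin> range (\<lambda>i. X$i)"
    using orthonormal_norm[OF assms] by (metis imageE norm_zero zero_neq_one)
qed

lemma orthonormal_dim:
  fixes X :: "real^'n^'p"
  assumes "orthonormal X"
  shows "dim (range (\<lambda>i. X$i)) = CARD('p)"
  using orthonormal_independent[OF assms] orthonormal_inj[OF assms]
  by (simp add: dim_eq_card_independent card_image)

lemma orthonormal_span:
  fixes X :: "real^'n^'p"
  assumes "orthonormal X" "subspace L" "dim L = CARD('p)" "\<And>i. X$i \<in> L"
  shows "span (range (\<lambda>i. X$i)) = L"
proof (rule subspace_dim_equal)
  show "span (range (\<lambda>i. X$i)) \<subseteq> L"
    using assms by (intro span_minimal) auto
qed (use assms orthonormal_dim[OF assms(1)] in auto)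

lemma orthonormal_expansion:
  fixes X :: "real^'n^'p"
  assumes "orthonormal X" "u \<in> span (range (\<lambda>i. X$i))"
  shows "u = (\<Sum>k\<in>UNIV. (u \<bullet> X$k) *\<^sub>R X$k)"
  using assms(2)
proof (induction rule: span_induct_alt)
  case base
  then show ?case by simp
next
  case (step c x y)
  then obtain i where x: "x = X$i" by auto
  have "X$i = (\<Sum>k\<in>UNIV. (X$i \<bullet> X$k) *\<^sub>R X$k)"
    by (simp add: orthonormal_inner[OF assms(1)] if_distrib[of "\<lambda>c. c *\<^sub>R _"] cong: if_cong)
  with step show ?case
    by (simp add: x inner_add_left scaleR_add_left sum.distrib flip: scaleR_scaleR scaleR_sum_right)
qed

lemma bessel_inequality:
  fixes X :: "real^'n^'p"
  assumes "orthonormal X"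
  shows "(\<Sum>k\<in>UNIV. (u \<bullet> X$k)\<^sup>2) \<le> u \<bullet> u"
proof -
  define y where "y = (\<Sum>k\<in>UNIV. (u \<bullet> X$k) *\<^sub>R X$k)"
  have uy: "u \<bullet> y = (\<Sum>k\<in>UNIV. (u \<bullet> X$k)\<^sup>2)"
    by (simp add: y_def inner_sum_right power2_eq_square)
  have "y \<bullet> X$k = u \<bullet> X$k" for k
    by (simp add: y_def inner_sum_left orthonormal_inner[OF assms] if_distrib cong: if_cong)
  then have yy: "y \<bullet> y = (\<Sum>k\<in>UNIV. (u \<bullet> X$k)\<^sup>2)"
    by (subst (2) y_def) (simp add: inner_sum_right power2_eq_square)
  have "0 \<le> (u - y) \<bullet> (u - y)" by simp
  also have "\<dots> = u \<bullet> u - 2 * (u \<bullet> y) + y \<bullet> y"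
    by (simp add: inner_diff inner_commute)
  finally show ?thesis using uy yy by linarith
qed

lemma parseval:
  fixes X :: "real^'n^'p"
  assumes "orthonormal X" "u \<in> span (range (\<lambda>i. X$i))"
  shows "(\<Sum>k\<in>UNIV. (u \<bullet> X$k)\<^sup>2) = u \<bullet> u"
  by (subst (2) orthonormal_expansion[OF assms])
    (simp add: inner_sum_right power2_eq_square inner_commute)

text \<open>One index after another receives a unit vector of \<open>S\<close> orthogonal to those
  already placed. With \<open>K\<close> empty this gives an orthonormal family in an abstract
  subspace; with larger \<open>K\<close> it later fills in vectors that the geometry leaves
  undetermined.\<close>

lemma orthonormal_extend:
  fixes u :: "'p::finite \<Rightarrow> real^'n"
  assumes S: "subspace S" "CARD('p) \<le> dim S"
    and uS: "\<And>i. i \<in> K \<Longrightarrow> u i \<in> S"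
    and u: "\<And>i j. i \<in> K \<Longrightarrow> j \<in> K \<Longrightarrow> u i \<bullet> u j = (if i = j then 1 else 0)"
  obtains v :: "real^'n^'p" where "orthonormal v" "\<And>i. v$i \<in> S" "\<And>i. i \<in> K \<Longrightarrow> v$i = u i"
proof -
  have "\<exists>v. (\<forall>i\<in>K \<union> J. v i \<in> S) \<and> (\<forall>i\<in>K \<union> J. \<forall>j\<in>K \<union> J. v i \<bullet> v j = (if i = j then 1 else 0))
     \<and> (\<forall>i\<in>K. v i = u i)" if "finite J" for J
    using that
  proof (induction J)
    case empty
    then show ?case using uS u by (intro exI[of _ u]) simp
  next
    case (insert b J)
    then obtain v where v: "\<forall>i\<in>K \<union> J. v i \<in> S"
      "\<forall>i\<in>K \<union> J. \<forall>j\<in>K \<union> J. v i \<bullet> v j = (if i = j then 1 else 0)" "\<forall>i\<in>K. v i = u i"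
      by blast
    show ?case
    proof (cases "b \<in> K \<union> J")
      case True
      then have "K \<union> insert b J = K \<union> J" by auto
      then show ?thesis using v by metis
    next
      case False
      \<comment> \<open>The index \<open>b\<close> is missing from \<open>K \<union> J\<close>, so
        fewer than \<open>CARD('p)\<close> vectors have been placed and their span misses some
        direction of \<open>S\<close>.\<close>
      have "dim (v ` (K \<union> J)) \<le> card (v ` (K \<union> J))" by (rule dim_le_card') simp
      also have "\<dots> \<le> card (K \<union> J)" by (rule card_image_le) simp
      also have "\<dots> < CARD('p)" using False by (intro psubset_card_mono) auto
      finally have "dim (v ` (K \<union> J)) < dim S" using S by simp
      moreover have "span (v ` (K \<union> J)) \<subseteq> span S" using v(1) by (intro span_mono) auto
      ultimately have "span (v ` (K \<union> J)) \<subset> span S"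
        by (metis dim_span order_less_irrefl psubsetI)
      then obtain x where x: "x \<noteq> 0" "x \<in> span S"
        "\<And>y. y \<in> span (v ` (K \<union> J)) \<Longrightarrow> orthogonal x y"
        by (rule orthogonal_to_subspace_exists_gen) blast
      define z where "z = x /\<^sub>R norm x"
      have zz: "z \<bullet> z = 1"
        using x(1) by (simp add: z_def dot_square_norm power2_eq_square)
      have zS: "z \<in> S" using x(2) S(1) by (simp add: z_def span_eq_iff[THEN iffD2] subspace_mul)
      have zv: "z \<bullet> v i = 0" if "i \<in> K \<union> J" for i
        using x(3)[OF span_base, of "v i"] that by (auto simp: z_def orthogonal_def)
      show ?thesis
      proof (intro exI[of _ "v(b := z)"] conjI ballI)
        fix i j assume "i \<in> K \<union> insert b J" "j \<in> K \<union> insert b J"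
        then show "(v(b := z)) i \<bullet> (v(b := z)) j = (if i = j then 1 else 0)"
          using v(2) zz zv False by (auto simp: inner_commute)
      qed (use v(1,3) zS False in auto)
    qed
  qed
  from this[of UNIV] obtain v where "\<forall>i. v i \<in> S" "\<forall>i j. v i \<bullet> v j = (if i = j then 1 else 0)"
    "\<forall>i\<in>K. v i = u i" by auto
  then show ?thesis
    by (intro that[of "\<chi> i. v i"]) (auto simp: orthonormal_def)
qed

section \<open>Principal vectors\<close>

text \<open>The value \<open>A\<close> is attained at angle 0, so the assumption makes 0 a maximum,
  and \<open>B\<close> is the derivative there.\<close>

lemma trig_max_at_zero:
  fixes A B :: real
  assumes "\<And>\<theta>. A * cos \<theta> + B * sin \<theta> \<le> A"
  shows "B = 0"
proof -
  have "((\<lambda>\<theta>. A * cos \<theta> + B * sin \<theta>) has_real_derivative B) (at 0)"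
    by (auto intro!: derivative_eq_intros)
  moreover have "\<forall>y. \<bar>0 - y\<bar> < 1 \<longrightarrow> A * cos y + B * sin y \<le> A * cos 0 + B * sin 0"
    using assms by simp
  ultimately show ?thesis using DERIV_local_max[of _ B 0 1] by auto
qed

text \<open>A Givens rotation of rows \<open>i\<close> and \<open>j\<close>: a one-parameter
  variation that keeps a family orthonormal and inside its subspace.\<close>

definition rotate_pair :: "'p \<Rightarrow> 'p \<Rightarrow> real \<Rightarrow> real^'n^'p \<Rightarrow> real^'n^'p" where
  "rotate_pair i j \<theta> X = (\<chi> k. if k = i then cos \<theta> *\<^sub>R X$i + sin \<theta> *\<^sub>R X$j
     else if k = j then cos \<theta> *\<^sub>R X$j - sin \<theta> *\<^sub>R X$i else X$k)"

lemma orthonormal_rotate_pair: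
  fixes X :: "real^'n^'p"
  assumes "orthonormal X" "i \<noteq> j"
  shows "orthonormal (rotate_pair i j \<theta> X)"
  unfolding orthonormal_def
proof (intro allI)
  fix k l
  have "cos \<theta> * cos \<theta> + sin \<theta> * sin \<theta> = 1"
    using sin_cos_squared_add3[of \<theta>] by simp
  then show "rotate_pair i j \<theta> X $ k \<bullet> rotate_pair i j \<theta> X $ l = (if k = l then 1 else 0)"
    using assms(2)
    by (auto simp: rotate_pair_def inner_add_left inner_add_right inner_diff_left inner_diff_right
        orthonormal_inner[OF assms(1)] algebra_simps)
qed

lemma sum_rotate_pair:
  fixes X :: "real^'n^'p" and g :: "'p \<Rightarrow> real^'n"
  assumes "i \<noteq> j"
  shows "(\<Sum>k\<in>UNIV. rotate_pair i j \<theta> X $ k \<bullet> g k) - (\<Sum>k\<in>UNIV. X$k \<bullet> g k)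
    = (X$i \<bullet> g i + X$j \<bullet> g j) * cos \<theta> + (X$j \<bullet> g i - X$i \<bullet> g j) * sin \<theta> - (X$i \<bullet> g i + X$j \<bullet> g j)"
proof -
  have "(\<Sum>k\<in>UNIV. rotate_pair i j \<theta> X $ k \<bullet> g k) - (\<Sum>k\<in>UNIV. X$k \<bullet> g k)
    = (\<Sum>k\<in>UNIV. (rotate_pair i j \<theta> X $ k - X$k) \<bullet> g k)"
    by (simp add: sum_subtractf inner_diff_left)
  also have "\<dots> = (\<Sum>k\<in>{i,j}. (rotate_pair i j \<theta> X $ k - X$k) \<bullet> g k)"
    by (rule sum.mono_neutral_right) (auto simp: rotate_pair_def)
  also have "\<dots> = (X$i \<bullet> g i + X$j \<bullet> g j) * cos \<theta> + (X$j \<bullet> g i - X$i \<bullet> g j) * sin \<theta>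
      - (X$i \<bullet> g i + X$j \<bullet> g j)"
    using assms by (simp add: rotate_pair_def inner_diff_left inner_add_left algebra_simps)
  finally show ?thesis .
qed

text \<open>First-order stationarity: by \<open>sum_rotate_pair\<close> the trace is
  \<open>A * cos \<theta> + B * sin \<theta>\<close> plus a constant, with \<open>B\<close> the
  difference of the two sides. An arbitrary \<open>g\<close> can absorb the weights and stand for
  either partner family.\<close>

lemma rotate_pair_max:
  fixes X :: "real^'n^'p" and g :: "'p \<Rightarrow> real^'n"
  assumes "i \<noteq> j"
    and "\<And>\<theta>. (\<Sum>k\<in>UNIV. rotate_pair i j \<theta> X $ k \<bullet> g k) \<le> (\<Sum>k\<in>UNIV. X$k \<bullet> g k)"
  shows "X$j \<bullet> g i = X$i \<bullet> g j"
proof -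
  have "X$j \<bullet> g i - X$i \<bullet> g j = 0"
  proof (rule trig_max_at_zero)
    fix \<theta>
    show "(X$i \<bullet> g i + X$j \<bullet> g j) * cos \<theta> + (X$j \<bullet> g i - X$i \<bullet> g j) * sin \<theta>
      \<le> X$i \<bullet> g i + X$j \<bullet> g j"
      using assms(2)[of \<theta>] sum_rotate_pair[OF assms(1), of \<theta> X g] by linarith
  qed
  then show ?thesis by simp
qed

lemma rotate_pair_in_subspace:
  assumes "subspace L" "\<And>k. X$k \<in> L"
  shows "rotate_pair i j \<theta> X $ k \<in> L"
  using assms by (simp add: rotate_pair_def subspace_add subspace_diff subspace_mul)

lemma compact_orthonormal_families:
  fixes L :: "(real^'n) set"
  assumes "subspace L"
  shows "compact {X :: real^'n^'p. orthonormal X \<and> (\<forall>i. X$i \<in> L)}" (is "compact ?S")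
proof -
  have "?S = (\<Inter>i. \<Inter>j. {X. X$i \<bullet> X$j = (if i = j then 1 else 0)}) \<inter> (\<Inter>i. (\<lambda>X. X$i) -` L)"
    by (auto simp: orthonormal_def)
  moreover have "closed {X :: real^'n^'p. X$i \<bullet> X$j = (if i = j then 1 else 0)}" for i j
    by (intro closed_Collect_eq continuous_intros)
  moreover have "closed ((\<lambda>X :: real^'n^'p. X$i) -` L)" for i
    using closed_subspace[OF assms] by (intro continuous_closed_vimage continuous_intros)
  ultimately have "closed ?S" by (simp only:) (intro closed_Int closed_INT ballI)
  moreover have "bounded ?S"
  proof (rule boundedI)
    fix X :: "real^'n^'p" assume "X \<in> ?S"
    then have "norm (X$i) = 1" for i by (simp add: orthonormal_norm)
    then show "norm X \<le> real CARD('p)"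
      using norm_vec_def[of X] L2_set_le_sum[of UNIV "\<lambda>i. norm (X$i)"] by simp
  qed
  ultimately show ?thesis by (simp add: compact_eq_bounded_closed)
qed

lemma orthonormal_swap:
  "orthonormal X \<Longrightarrow> orthonormal (\<chi> k. X $ (Transposition.transpose i j k))"
  by (auto simp: orthonormal_def transpose_eq_iff)

text \<open>The principal vectors are found by maximising a weighted trace with distinct weights: at a
  maximum, rotating two of the vectors kills the off-diagonal inner products, a sign change gives
  nonnegativity, and a transposition gives the ordering.\<close>

lemma principal_vectors_exist:
  fixes L M :: "(real^'n) set"
  assumes L: "subspace L" "dim L = CARD('p::{finite,linorder})"
    and M: "subspace M" "dim M = CARD('p)"
  obtains X Y :: "real^'n^('p::{finite,linorder})" where "orthonormal X" "\<And>i. X$i \<in> L" "orthonormal Y" "\<And>i. Y$i \<in> M"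
    "\<And>i j. i \<noteq> j \<Longrightarrow> X$i \<bullet> Y$j = 0" "\<And>i. 0 \<le> X$i \<bullet> Y$i"
    "\<And>i j. i \<le> j \<Longrightarrow> X$j \<bullet> Y$j \<le> X$i \<bullet> Y$i"
proof -
  \<comment> \<open>Strictly decreasing positive weights: \<open>{i..}\<close> shrinks as
    \<open>i\<close> grows. Distinctness forces the off-diagonal entries to vanish, and the
    direction makes the diagonal decrease.\<close>
  define w where "w i = real (card {i::'p..})" for i
  have w_pos: "0 < w i" for i by (auto simp: w_def card_gt_0_iff)
  have w_less: "w j < w i" if "i < j" for i j
    unfolding w_def of_nat_less_iff using that by (intro psubset_card_mono) auto
  define F where "F K = {X :: real^'n^('p::{finite,linorder}). orthonormal X \<and> (\<forall>i. X$i \<in> K)}" for K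
  define f where "f = (\<lambda>(X :: real^'n^('p::{finite,linorder}), Y). \<Sum>k\<in>UNIV. w k * (X$k \<bullet> Y$k))"
  have ne: "F K \<noteq> {}" if "subspace K" "dim K = CARD('p)" for K
    using orthonormal_extend[of K "{}"] that by (auto simp: F_def)
  have "compact (F L \<times> F M)"
    unfolding F_def by (intro compact_Times compact_orthonormal_families L M)
  moreover have "F L \<times> F M \<noteq> {}" using ne L M by auto
  moreover have "continuous_on (F L \<times> F M) f"
    unfolding f_def case_prod_unfold by (intro continuous_intros)
  ultimately obtain P where P: "P \<in> F L \<times> F M" "\<And>Q. Q \<in> F L \<times> F M \<Longrightarrow> f Q \<le> f P"
    using continuous_attains_sup by meson
  obtain X Y where XY: "P = (X, Y)" by fastforce
  have X: "orthonormal X" "\<And>i. X$i \<in> L" and Y: "orthonormal Y" "\<And>i. Y$i \<in> M"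
    using P(1) by (auto simp: XY F_def)
  have max: "(\<Sum>k\<in>UNIV. w k * (X'$k \<bullet> Y'$k)) \<le> (\<Sum>k\<in>UNIV. w k * (X$k \<bullet> Y$k))"
    if "orthonormal X'" "\<And>i. X'$i \<in> L" "orthonormal Y'" "\<And>i. Y'$i \<in> M" for X' Y'
    using P(2)[of "(X', Y')"] that by (auto simp: XY F_def f_def)
  have off: "X$i \<bullet> Y$j = 0" if ij: "i \<noteq> j" for i j
  proof -
    have "X$j \<bullet> (w i *\<^sub>R Y$i) = X$i \<bullet> (w j *\<^sub>R Y$j)"
    proof (rule rotate_pair_max[OF ij])
      show "(\<Sum>k\<in>UNIV. rotate_pair i j \<theta> X $ k \<bullet> w k *\<^sub>R Y $ k) \<le> (\<Sum>k\<in>UNIV. X $ k \<bullet> w k *\<^sub>R Y $ k)" for \<theta>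
        using max[OF orthonormal_rotate_pair[OF X(1) ij] rotate_pair_in_subspace[OF L(1) X(2)] Y]
        by simp
    qed
    moreover have "Y$j \<bullet> (w i *\<^sub>R X$i) = Y$i \<bullet> (w j *\<^sub>R X$j)"
    proof (rule rotate_pair_max[OF ij])
      show "(\<Sum>k\<in>UNIV. rotate_pair i j \<theta> Y $ k \<bullet> w k *\<^sub>R X $ k) \<le> (\<Sum>k\<in>UNIV. Y $ k \<bullet> w k *\<^sub>R X $ k)" for \<theta>
        using max[OF X orthonormal_rotate_pair[OF Y(1) ij] rotate_pair_in_subspace[OF M(1) Y(2)]]
        by (simp add: inner_commute)
    qed
    ultimately have e: "w i * (X$j \<bullet> Y$i) = w j * (X$i \<bullet> Y$j)" "w i * (X$i \<bullet> Y$j) = w j * (X$j \<bullet> Y$i)"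
      by (simp_all add: inner_commute)
    \<comment> \<open>The two stationarity conditions, from rotating \<open>X\<close> and from
      rotating \<open>Y\<close>, combine to a relation for \<open>X$i \<bullet> Y$j\<close> alone;
      weights that are positive and distinct have distinct squares, which leaves only 0.\<close>
    have "(w i)\<^sup>2 * (X$i \<bullet> Y$j) = w j * (w i * (X$j \<bullet> Y$i))"
      using e(2) by (simp add: power2_eq_square)
    also have "\<dots> = (w j)\<^sup>2 * (X$i \<bullet> Y$j)" using e(1) by (simp add: power2_eq_square)
    finally have "((w i)\<^sup>2 - (w j)\<^sup>2) * (X$i \<bullet> Y$j) = 0" by (simp add: algebra_simps)
    moreover have "w i \<noteq> w j" using w_less[of i j] w_less[of j i] ij by (cases i j rule: linorder_cases) auto
    then have "(w i)\<^sup>2 \<noteq> (w j)\<^sup>2"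
      using w_pos[of i] w_pos[of j] by (metis less_imp_le power2_eq_imp_eq)
    ultimately show ?thesis by simp
  qed
  have nonneg: "0 \<le> X$i \<bullet> Y$i" for i
  proof -
    define X' where "X' = (\<chi> k. if k = i then - X$k else X$k)"
    have "(\<Sum>k\<in>UNIV. w k * (X'$k \<bullet> Y$k)) \<le> (\<Sum>k\<in>UNIV. w k * (X$k \<bullet> Y$k))"
      using X Y L(1) by (intro max) (auto simp: X'_def orthonormal_def subspace_neg)
    moreover have "(\<Sum>k\<in>UNIV. w k * (X$k \<bullet> Y$k)) - (\<Sum>k\<in>UNIV. w k * (X'$k \<bullet> Y$k))
      = (\<Sum>k\<in>UNIV. if k = i then 2 * w i * (X$i \<bullet> Y$i) else 0)"
      unfolding sum_subtractf[symmetric] by (rule sum.cong) (auto simp: X'_def)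
    ultimately have "0 \<le> w i * (X$i \<bullet> Y$i)" by simp
    then show ?thesis using w_pos[of i] by (simp add: zero_le_mult_iff)
  qed
  have sorted: "X$j \<bullet> Y$j \<le> X$i \<bullet> Y$i" if ij: "i \<le> j" for i j
  proof (cases "i = j")
    case False
    then have "i < j" using ij by simp
    define X' Y' where "X' = (\<chi> k. X $ (Transposition.transpose i j k))"
      and "Y' = (\<chi> k. Y $ (Transposition.transpose i j k))"
    have "(\<Sum>k\<in>UNIV. w k * (X'$k \<bullet> Y'$k)) \<le> (\<Sum>k\<in>UNIV. w k * (X$k \<bullet> Y$k))"
      using X Y by (intro max) (auto simp: X'_def Y'_def orthonormal_swap)
    moreover have "(\<Sum>k\<in>UNIV. w k * (X$k \<bullet> Y$k)) - (\<Sum>k\<in>UNIV. w k * (X'$k \<bullet> Y'$k))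
      = (\<Sum>k\<in>{i,j}. w k * (X$k \<bullet> Y$k) - w k * (X'$k \<bullet> Y'$k))"
      unfolding sum_subtractf[symmetric]
      by (rule sum.mono_neutral_right) (auto simp: X'_def Y'_def transpose_def)
    moreover have "\<dots> = (w i - w j) * (X$i \<bullet> Y$i - X$j \<bullet> Y$j)"
      using False by (simp add: X'_def Y'_def algebra_simps)
    ultimately have "0 \<le> (w i - w j) * (X$i \<bullet> Y$i - X$j \<bullet> Y$j)" by simp
    then show ?thesis using w_less[OF \<open>i < j\<close>] by (simp add: zero_le_mult_iff)
  qed simp
  show ?thesis using that[OF X Y off nonneg sorted] by simp
qed

section \<open>Uniqueness of the diagonal form, hence of the Jordan angles\<close>

lemma diagonal_gram_projection:
  fixes X Y :: "real^'n^'p"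
  assumes "\<And>i j. X$i \<bullet> Y$j = (if i = j then s$i else 0)" "orthonormal Y"
    and "u \<in> span (range (\<lambda>i. Y$i))"
  shows "X$i \<bullet> u = s$i * (Y$i \<bullet> u)"
  using assms(3)
proof (induction rule: span_induct_alt)
  case (step c x y)
  then show ?case
    using assms(1) by (auto simp: inner_add_right orthonormal_inner[OF assms(2)] algebra_simps
        split: if_splits)
qed simp

text \<open>Both \<open>X\<close> and \<open>X'\<close> diagonalise the same operator, so \<open>X$i\<close> and \<open>X'$j\<close> are orthogonal unless
  \<open>s$i = s'$j\<close>; a zero block of size \<open>j \<times> (p + 1 - j)\<close> in an orthogonal matrix is too large.\<close>

lemma diagonal_gram_le:
  fixes X Y X' Y' :: "real^'n^('p::{finite,linorder})"
  assumes X: "orthonormal X" and Y: "orthonormal Y" and X': "orthonormal X'" and Y': "orthonormal Y'"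
    and spX: "span (range (\<lambda>i. X$i)) = span (range (\<lambda>i. X'$i))"
    and spY: "span (range (\<lambda>i. Y$i)) = span (range (\<lambda>i. Y'$i))"
    and s: "\<And>i j. X$i \<bullet> Y$j = (if i = j then s$i else 0)"
    and s': "\<And>i j. X'$i \<bullet> Y'$j = (if i = j then s'$i else 0)"
    and nn: "\<And>i. 0 \<le> s$i" "\<And>i. 0 \<le> s'$i"
    and mono: "\<And>i j. i \<le> j \<Longrightarrow> s$j \<le> s$i" "\<And>i j. i \<le> j \<Longrightarrow> s'$j \<le> s'$i"
  shows "s$j \<le> s'$j"
proof (rule ccontr)
  assume less: "\<not> s$j \<le> s'$j"
  have inX: "X$i \<in> span (range (\<lambda>i. X$i))" "X'$i \<in> span (range (\<lambda>i. X'$i))"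
    "Y$i \<in> span (range (\<lambda>i. Y$i))" "Y'$i \<in> span (range (\<lambda>i. Y'$i))" for i
    by (auto intro: span_base)
  \<comment> \<open>Projecting \<open>X$i\<close> to the span of \<open>Y\<close> and back
    multiplies it by \<open>(s$i)\<^sup>2\<close>, and likewise \<open>X'$k\<close> by
    \<open>(s'$k)\<^sup>2\<close>. The two are compared through
    \<open>Y$i \<bullet> Y'$k\<close>.\<close>
  have eig: "(s$i)\<^sup>2 * (X$i \<bullet> X'$k) = (s'$k)\<^sup>2 * (X$i \<bullet> X'$k)" for i k
  proof -
    have s_swap: "Y$i \<bullet> X$j = (if i = j then s$i else 0)" "Y'$i \<bullet> X'$j = (if i = j then s'$i else 0)" for i j
      using s s' by (auto simp: inner_commute)
    have "X$i \<bullet> Y'$k = s$i * (Y$i \<bullet> Y'$k)"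
      using inX spY by (intro diagonal_gram_projection[OF s Y]) simp
    moreover have "Y'$k \<bullet> X$i = s'$k * (X'$k \<bullet> X$i)"
      using inX spX by (intro diagonal_gram_projection[OF s_swap(2) X']) auto
    moreover have "Y$i \<bullet> X'$k = s$i * (X$i \<bullet> X'$k)"
      using inX spX by (intro diagonal_gram_projection[OF s_swap(1) X]) auto
    moreover have "X'$k \<bullet> Y$i = s'$k * (Y'$k \<bullet> Y$i)"
      using inX spY by (intro diagonal_gram_projection[OF s' Y']) auto
    ultimately have e: "s$i * (Y$i \<bullet> Y'$k) = s'$k * (X$i \<bullet> X'$k)" "s$i * (X$i \<bullet> X'$k) = s'$k * (Y$i \<bullet> Y'$k)"
      by (simp_all add: inner_commute)
    have "(s$i)\<^sup>2 * (X$i \<bullet> X'$k) = s'$k * (s$i * (Y$i \<bullet> Y'$k))"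
      using e(2) by (simp add: power2_eq_square)
    then show ?thesis using e(1) by (simp add: power2_eq_square)
  qed
  have zero: "X$i \<bullet> X'$k = 0" if "i \<le> j" "j \<le> k" for i k
  proof -
    have "s'$k < s$i" using mono(1)[OF that(1)] mono(2)[OF that(2)] less by linarith
    then have "(s'$k)\<^sup>2 \<noteq> (s$i)\<^sup>2" using nn by (metis order_less_irrefl power2_eq_iff_nonneg)
    then show ?thesis using eig[of i k] by auto
  qed
  \<comment> \<open>Double counting of the squared entries in the rows up to \<open>j\<close>:
    Parseval along the rows gives the number of rows, while the zero block confines the mass to the
    columns before \<open>j\<close>, where Bessel bounds it by their smaller number.\<close>
  have "real (card {..j}) = (\<Sum>i\<in>{..j}. \<Sum>k\<in>UNIV. (X$i \<bullet> X'$k)\<^sup>2)"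
    using parseval[OF X'] inX spX by (simp add: orthonormal_inner[OF X])
  also have "\<dots> = (\<Sum>i\<in>{..j}. \<Sum>k\<in>{..<j}. (X$i \<bullet> X'$k)\<^sup>2)"
    using zero by (intro sum.cong sum.mono_neutral_right) (auto simp: not_less)
  also have "\<dots> = (\<Sum>k\<in>{..<j}. \<Sum>i\<in>{..j}. (X'$k \<bullet> X$i)\<^sup>2)"
    by (subst sum.swap) (simp add: inner_commute)
  also have "\<dots> \<le> (\<Sum>k\<in>{..<j}. \<Sum>i\<in>UNIV. (X'$k \<bullet> X$i)\<^sup>2)"
    by (intro sum_mono sum_mono2) auto
  also have "\<dots> \<le> (\<Sum>k\<in>{..<j}. X'$k \<bullet> X'$k)"
    by (intro sum_mono bessel_inequality[OF X])
  also have "\<dots> = real (card {..<j})" by (simp add: orthonormal_inner[OF X'])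
  finally have "card {..j} \<le> card {..<j}" by simp
  moreover have "card {..<j} < card {..j}" by (intro psubset_card_mono) auto
  ultimately show False by simp
qed

text \<open>The columns of the orthogonal factors \<open>U\<close> and \<open>V\<close> serve as
  coefficient vectors: in the bases they define, the Gram matrix \<open>G\<close> becomes
  \<open>transpose U ** G ** V\<close>, which cancels both factors.\<close>

lemma singular_values_diagonalise:
  fixes L M :: "(real^'n) set" and s :: "real^('p::{finite,linorder})"
  assumes "orthonormal_basis L e" "orthonormal_basis M f" "singular_values (gram e f) s"
  obtains X Y :: "real^'n^('p::{finite,linorder})" where "orthonormal X" "\<And>i. X$i \<in> L"
    "orthonormal Y" "\<And>i. Y$i \<in> M" "\<And>i j. X$i \<bullet> Y$j = (if i = j then s$i else 0)"
proof -
  obtain U V where U: "orthogonal_matrix U" and V: "orthogonal_matrix V"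
    and A: "gram e f = U ** (\<chi> i j. if i = j then s$i else 0) ** transpose V"
    using assms(3) by (auto simp: singular_values_def)
  define comb where "comb W g = (\<chi> i. \<Sum>k\<in>UNIV. W$k$i *\<^sub>R g k)"
    for W :: "real^('p::{finite,linorder})^('p::{finite,linorder})" and g :: "'p \<Rightarrow> real^'n"
  have inner: "comb W g $ i \<bullet> comb W' g' $ j = (transpose W ** gram g g' ** W') $ i $ j" for W W' g g' i j
    by (simp add: comb_def gram_def matrix_matrix_mult_def transpose_def inner_sum_left inner_sum_right
        sum_distrib_left sum_distrib_right mult_ac)
  have ON: "orthonormal (comb W g)" if "orthonormal_basis K g" "orthogonal_matrix W" for W g K
  proof -
    have "gram g g = mat 1" using that(1) by (simp add: gram_def orthonormal_basis_def mat_def)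
    then show ?thesis
      using that(2) by (simp add: orthonormal_def inner orthogonal_matrix) (simp add: mat_def)
  qed
  have sub: "comb W g $ i \<in> K" if "orthonormal_basis K g" for W g K i
  proof -
    have "comb W g $ i \<in> span (range g)"
      by (simp add: comb_def) (intro span_sum span_mul span_base, simp)
    then show ?thesis using that by (simp add: orthonormal_basis_def)
  qed
  have "transpose U ** gram e f ** V
    = (transpose U ** U) ** (\<chi> i j. if i = j then s$i else 0) ** (transpose V ** V)"
    by (simp add: A matrix_mul_assoc)
  also have "\<dots> = (\<chi> i j. if i = j then s$i else 0)"
    using U V by (simp add: orthogonal_matrix)
  finally have "comb U e $ i \<bullet> comb V f $ j = (if i = j then s$i else 0)" for i j
    by (simp add: inner)
  then show ?thesis
    using that[OF ON[OF assms(1) U] sub[OF assms(1)] ON[OF assms(2) V] sub[OF assms(2)]] by blast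
qed

text \<open>The definition picks a singular value vector by \<open>SOME\<close>. The given diagonal
  form shows that one exists, with both orthogonal factors the identity, and
  \<open>diagonal_gram_le\<close> in both directions shows that the pick agrees with
  \<open>s\<close>.\<close>

lemma jordan_angles_eq:
  fixes X Y :: "real^'n^('p::{finite,linorder})"
  assumes L: "subspace L" "dim L = CARD('p)" and M: "subspace M" "dim M = CARD('p)"
    and X: "orthonormal X" "\<And>i. X$i \<in> L" and Y: "orthonormal Y" "\<And>i. Y$i \<in> M"
    and s: "\<And>i j. X$i \<bullet> Y$j = (if i = j then s$i else 0)"
    and nn: "\<And>i. 0 \<le> s$i" and mono: "\<And>i j. i \<le> j \<Longrightarrow> s$j \<le> s$i"
  shows "jordan_angles L M = (\<chi> j. arccos (s$j))"
proof -
  let ?P = "\<lambda>s. \<exists>e f. orthonormal_basis L (e :: 'p \<Rightarrow> _) \<and> orthonormal_basis M f \<and>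
    singular_values (gram e f) s"
  have basis: "orthonormal_basis K (\<lambda>i. Z$i)"
    if "orthonormal Z" "\<And>i. Z$i \<in> K" "subspace K" "dim K = CARD('p)" for Z :: "real^'n^('p::{finite,linorder})" and K
    using that orthonormal_span[OF that(1,3,4,2)] by (auto simp: orthonormal_basis_def orthonormal_def)
  have "singular_values (gram (\<lambda>i. X$i) (\<lambda>i. Y$i)) s"
    unfolding singular_values_def
  proof (intro conjI exI[of _ "mat 1"])
    show "gram (\<lambda>i. X$i) (\<lambda>i. Y$i) = mat 1 ** (\<chi> i j. if i = j then s$i else 0) ** transpose (mat 1)"
      by (simp add: gram_def s transpose_mat)
  qed (use nn mono in \<open>auto simp: orthogonal_matrix_id\<close>)
  then have "?P s" using basis[OF X L] basis[OF Y M] by blast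
  then have P: "?P (Eps ?P)" by (rule someI)
  define s' where "s' = Eps ?P"
  obtain e f where ef: "orthonormal_basis L (e :: 'p \<Rightarrow> _)" "orthonormal_basis M f" "singular_values (gram e f) s'"
    using P unfolding s'_def by blast
  obtain X' Y' :: "real^'n^('p::{finite,linorder})" where X': "orthonormal X'" "\<And>i. X'$i \<in> L"
    and Y': "orthonormal Y'" "\<And>i. Y'$i \<in> M" and s': "\<And>i j. X'$i \<bullet> Y'$j = (if i = j then s'$i else 0)"
    by (rule singular_values_diagonalise[OF ef]) blast
  have nn': "\<And>i. 0 \<le> s'$i" and mono': "\<And>i j. i \<le> j \<Longrightarrow> s'$j \<le> s'$i"
    using ef(3) by (auto simp: singular_values_def)
  have sp: "span (range (\<lambda>i. X$i)) = span (range (\<lambda>i. X'$i))"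
    "span (range (\<lambda>i. Y$i)) = span (range (\<lambda>i. Y'$i))"
    using orthonormal_span[OF X(1) L X(2)] orthonormal_span[OF X'(1) L X'(2)]
      orthonormal_span[OF Y(1) M Y(2)] orthonormal_span[OF Y'(1) M Y'(2)] by auto
  have "s$j = s'$j" for j
    using diagonal_gram_le[OF X(1) Y(1) X'(1) Y'(1) sp s s' nn nn' mono mono', of j]
      diagonal_gram_le[OF X'(1) Y'(1) X(1) Y(1) sp[symmetric] s' s nn' nn mono' mono, of j] by simp
  then have "s' = s" by (simp add: vec_eq_iff)
  then show ?thesis
    unfolding jordan_angles_def Let_def using s'_def by simp
qed

section \<open>Frames\<close>

definition combine :: "('p \<Rightarrow> real) \<Rightarrow> ('p \<Rightarrow> real) \<Rightarrow> real^'n^'p \<Rightarrow> real^'n^'p \<Rightarrow> real^'n^'p" where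
  "combine a b x v = (\<chi> i. a i *\<^sub>R x$i + b i *\<^sub>R v$i)"

lemma combine_nth [simp]: "combine a b x v $ i = a i *\<^sub>R x$i + b i *\<^sub>R v$i"
  by (simp add: combine_def)

lemma combine_inner:
  assumes "orthonormal x" "orthonormal v" "\<And>i j. x$i \<bullet> v$j = 0"
  shows "combine a b x v $ i \<bullet> combine c d x v $ j = (if i = j then a i * c i + b i * d i else 0)"
  using assms(3)
  by (simp add: inner_add_left inner_add_right orthonormal_inner[OF assms(1)]
      orthonormal_inner[OF assms(2)] inner_commute[of "v$i" "x$j"])

lemma orthonormal_combine:
  assumes "orthonormal x" "orthonormal v" "\<And>i j. x$i \<bullet> v$j = 0" "\<And>i. (a i)\<^sup>2 + (b i)\<^sup>2 = 1"
  shows "orthonormal (combine a b x v)"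
  unfolding orthonormal_def combine_inner[OF assms(1-3)] using assms(4) by (simp add: power2_eq_square)

text \<open>In the planes spanned by \<open>x$i\<close> and \<open>v$i\<close>, the subspace \<open>M\<close> is \<open>L\<close> turned by the angle \<open>\<theta>$i\<close>.
  Where \<open>\<theta>$i = 0\<close> the vector \<open>v$i\<close> is arbitrary; there is room for it because \<open>p \<le> q\<close>.\<close>

definition angle_frame ::
  "(real^'n) set \<Rightarrow> (real^'n) set \<Rightarrow> real^'n^('p::{finite,linorder}) \<Rightarrow> real^'n^('p::{finite,linorder})
    \<Rightarrow> real^('p::{finite,linorder}) \<Rightarrow> bool" where
  "angle_frame L M x v \<theta> \<longleftrightarrow>
     orthonormal x \<and> (\<forall>i. x$i \<in> L) \<and> orthonormal v \<and> (\<forall>i. v$i \<in> orthogonal_comp L) \<and>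
     (\<forall>i. 0 \<le> \<theta>$i \<and> \<theta>$i \<le> pi/2) \<and> (\<forall>i j. i \<le> j \<longrightarrow> \<theta>$i \<le> \<theta>$j) \<and>
     (\<forall>i. cos (\<theta>$i) *\<^sub>R x$i + sin (\<theta>$i) *\<^sub>R v$i \<in> M)"

text \<open>The rows are the principal vectors of \<open>M\<close> matched with those of
  \<open>L\<close>.\<close>

definition frame_base :: "real^'n^'p \<Rightarrow> real^'n^'p \<Rightarrow> real^'p \<Rightarrow> real^'n^'p" where
  "frame_base x v \<theta> = combine (\<lambda>i. cos (\<theta>$i)) (\<lambda>i. sin (\<theta>$i)) x v"

text \<open>Row by row this is minus the derivative of \<open>frame_base\<close> in the angle: the
  perpendicular direction within the same plane.\<close>

definition frame_normal :: "real^'n^'p \<Rightarrow> real^'n^'p \<Rightarrow> real^'p \<Rightarrow> real^'n^'p" where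
  "frame_normal x v \<theta> = combine (\<lambda>i. sin (\<theta>$i)) (\<lambda>i. - cos (\<theta>$i)) x v"

lemma inner_orthogonal_comp: "x \<in> L \<Longrightarrow> v \<in> orthogonal_comp L \<Longrightarrow> x \<bullet> v = 0"
  by (simp add: orthogonal_comp_def orthogonal_def)

context
  fixes L M :: "(real^'n) set" and x v :: "real^'n^('p::{finite,linorder})" and \<theta> :: "real^('p::{finite,linorder})"
  assumes frame: "angle_frame L M x v \<theta>"
begin

lemma frame_orthonormal: "orthonormal x" "orthonormal v" "x$i \<bullet> v$j = 0"
  using frame by (auto simp: angle_frame_def intro: inner_orthogonal_comp)

lemma orthonormal_frame_base: "orthonormal (frame_base x v \<theta>)"
  unfolding frame_base_def by (intro orthonormal_combine frame_orthonormal) simp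

lemma orthonormal_frame_normal: "orthonormal (frame_normal x v \<theta>)"
  unfolding frame_normal_def by (intro orthonormal_combine frame_orthonormal) simp

lemma frame_base_in: "frame_base x v \<theta> $ i \<in> M"
  using frame by (simp add: angle_frame_def frame_base_def)

text \<open>Base and normal are perpendicular within each plane, different planes are orthogonal,
  and by dimension the base vectors span all of \<open>M\<close>.\<close>

lemma frame_normal_orthogonal:
  assumes M: "subspace M" "dim M = CARD('p)" and u: "u \<in> M"
  shows "frame_normal x v \<theta> $ i \<bullet> u = 0"
proof -
  have "u \<in> span (range (\<lambda>i. frame_base x v \<theta> $ i))"
    using u orthonormal_span[OF orthonormal_frame_base M frame_base_in] by simp
  then show ?thesis
  proof (induction rule: span_induct_alt)
    case (step c z y)
    then obtain k where "z = frame_base x v \<theta> $ k" by auto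
    then have "frame_normal x v \<theta> $ i \<bullet> z = 0"
      unfolding frame_base_def frame_normal_def
      by (simp only: combine_inner[OF frame_orthonormal]) simp
    then show ?case using step by (simp add: inner_add_right)
  qed simp
qed

text \<open>The Gram matrix of \<open>x\<close> against \<open>frame_base\<close> is diagonal with
  entries \<open>cos (\<theta>$i)\<close>, which decrease because cosine does on the range of the
  angles. So a frame, although not unique, determines its angles.\<close>

lemma angle_frame_jordan_angles:
  assumes L: "subspace L" "dim L = CARD('p)" and M: "subspace M" "dim M = CARD('p)"
  shows "jordan_angles L M = \<theta>"
proof -
  have \<theta>: "0 \<le> \<theta>$i" "\<theta>$i \<le> pi/2" "i \<le> j \<Longrightarrow> \<theta>$i \<le> \<theta>$j" for i j
    using frame by (auto simp: angle_frame_def)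
  have "arccos (cos (\<theta>$i)) = \<theta>$i" for i
    using \<theta>(1,2)[of i] pi_gt_zero by (intro arccos_cos) linarith+
  then have "\<theta> = (\<chi> j. arccos ((\<chi> j. cos (\<theta>$j)) $ j))" by (simp add: vec_eq_iff)
  also have "\<dots> = jordan_angles L M"
  proof (rule sym, rule jordan_angles_eq[OF L M])
    show "orthonormal x" "x$i \<in> L" for i using frame by (auto simp: angle_frame_def)
    show "x$i \<bullet> frame_base x v \<theta> $ j = (if i = j then (\<chi> j. cos (\<theta>$j)) $ i else 0)" for i j
      using frame_orthonormal by (auto simp: frame_base_def inner_add_right orthonormal_inner)
    show "0 \<le> (\<chi> j. cos (\<theta>$j)) $ i" for i
      using \<theta>[of i] by (simp add: cos_ge_zero)
    show "(\<chi> j. cos (\<theta>$j)) $ j \<le> (\<chi> j. cos (\<theta>$j)) $ i" if "i \<le> j" for i j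
      using \<theta>[of i] \<theta>[of j] \<theta>(3)[OF that] by (simp add: cos_mono_le_eq)
  qed (rule orthonormal_frame_base frame_base_in)+
  finally show ?thesis by simp
qed

end

text \<open>Principal vectors \<open>x\<close>, \<open>y\<close> are taken and \<open>y$i\<close> is
  split into its part along \<open>x$i\<close> and a remainder \<open>r i\<close>. The remainders
  are mutually orthogonal, perpendicular to \<open>L\<close> and of length
  \<open>sin (\<theta>$i)\<close>; where this is nonzero, normalising gives
  \<open>v$i\<close>.\<close>

lemma angle_frame_exists:
  fixes L M :: "(real^'n) set"
  assumes pq: "CARD('p::{finite,linorder}) \<le> CARD('n) - CARD('p)"
    and L: "subspace L" "dim L = CARD('p)" and M: "subspace M" "dim M = CARD('p)"
  obtains x v :: "real^'n^('p::{finite,linorder})" and \<theta> where "angle_frame L M x v \<theta>"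
proof -
  obtain x y :: "real^'n^('p::{finite,linorder})" where x: "orthonormal x" "\<And>i. x$i \<in> L"
    and y: "orthonormal y" "\<And>i. y$i \<in> M" and off: "\<And>i j. i \<noteq> j \<Longrightarrow> x$i \<bullet> y$j = 0"
    and nn: "\<And>i. 0 \<le> x$i \<bullet> y$i" and mono: "\<And>i j. i \<le> j \<Longrightarrow> x$j \<bullet> y$j \<le> x$i \<bullet> y$i"
    by (rule principal_vectors_exist[OF L M]) blast
  define s where "s i = x$i \<bullet> y$i" for i
  define \<theta> where "\<theta> = (\<chi> i. arccos (s i))"
  have s_le: "s i \<le> 1" for i
    using norm_cauchy_schwarz[of "x$i" "y$i"] by (simp add: s_def orthonormal_norm x(1) y(1))
  have s_bd: "0 \<le> s i" "-1 \<le> s i" for i using nn[of i] by (simp_all add: s_def)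
  have cos_\<theta>: "cos (\<theta>$i) = s i" for i using s_le s_bd by (simp add: \<theta>_def)
  have \<theta>_bd: "0 \<le> \<theta>$i" "\<theta>$i \<le> pi/2" for i
    using s_le[of i] s_bd[of i] arccos_le_pi2[of "s i"] by (simp_all add: \<theta>_def arccos_lbound)
  have \<theta>_mono: "\<theta>$i \<le> \<theta>$j" if "i \<le> j" for i j
    using mono[OF that] s_le s_bd by (simp add: \<theta>_def s_def arccos_le_arccos)
  define r where "r i = y$i - s i *\<^sub>R x$i" for i
  have xy: "x$i \<bullet> y$j = (if i = j then s i else 0)" for i j using off by (simp add: s_def)
  have r_perp: "r i \<in> orthogonal_comp L" for i
  proof -
    have "z \<bullet> r i = 0" if "z \<in> span (range (\<lambda>i. x$i))" for z
      using that
    proof (induction rule: span_induct_alt)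
      case (step c z' y')
      then obtain k where "z' = x$k" by auto
      then have "z' \<bullet> r i = 0" using xy[of k i] by (simp add: r_def inner_diff_right orthonormal_inner[OF x(1)])
      then show ?case using step by (simp add: inner_add_left)
    qed simp
    then show ?thesis
      unfolding orthonormal_span[OF x(1) L x(2)] by (simp add: orthogonal_comp_def orthogonal_def)
  qed
  have sin_\<theta>: "(sin (\<theta>$i))\<^sup>2 = 1 - s i * s i" for i
    unfolding sin_squared_eq cos_\<theta> by (simp add: power2_eq_square)
  have rr: "r i \<bullet> r j = (if i = j then (sin (\<theta>$i))\<^sup>2 else 0)" for i j
    using xy[of i j] xy[of j i]
    by (simp add: r_def inner_diff_left inner_diff_right orthonormal_inner[OF x(1)] orthonormal_inner[OF y(1)]
        inner_commute[of "y$i" "x$j"] sin_\<theta>)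
  define K where "K = {i. sin (\<theta>$i) \<noteq> 0}"
  have "dim (orthogonal_comp L) + dim L = CARD('n)"
    using dim_subspace_orthogonal_to_vectors[of L UNIV] L by (simp add: orthogonal_comp_def)
  \<comment> \<open>Here \<open>p \<le> q\<close> enters: the complement of \<open>L\<close> can
    hold \<open>p\<close> orthonormal vectors.\<close>
  then have "CARD('p) \<le> dim (orthogonal_comp L)" using pq L by simp
  moreover have "(r i /\<^sub>R sin (\<theta>$i)) \<bullet> (r j /\<^sub>R sin (\<theta>$j)) = (if i = j then 1 else 0)" if "i \<in> K" "j \<in> K" for i j
    using that by (simp add: rr K_def power2_eq_square field_simps)
  moreover have "r i /\<^sub>R sin (\<theta>$i) \<in> orthogonal_comp L" for i
    by (intro subspace_mul subspace_orthogonal_comp r_perp)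
  ultimately obtain v :: "real^'n^('p::{finite,linorder})" where v: "orthonormal v"
    "\<And>i. v$i \<in> orthogonal_comp L" "\<And>i. i \<in> K \<Longrightarrow> v$i = r i /\<^sub>R sin (\<theta>$i)"
    using orthonormal_extend[OF subspace_orthogonal_comp, of L K "\<lambda>i. r i /\<^sub>R sin (\<theta>$i)"] by blast
  \<comment> \<open>Off \<open>K\<close> both sides are 0, the remainder because its squared norm is
    the squared sine.\<close>
  have "sin (\<theta>$i) *\<^sub>R v$i = r i" for i
    using v(3)[of i] rr[of i i] by (cases "i \<in> K") (auto simp: K_def)
  then have "cos (\<theta>$i) *\<^sub>R x$i + sin (\<theta>$i) *\<^sub>R v$i = y$i" for i
    by (simp add: r_def cos_\<theta>)
  then have "angle_frame L M x v \<theta>"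
    unfolding angle_frame_def using x v y(2) \<theta>_bd \<theta>_mono by auto
  then show ?thesis by (rule that)
qed

section \<open>The support function of the orbit\<close>

text \<open>Some permutation maximises the pairing with strictly increasing weights
  \<open>r\<close>; a transposition repairing a descent would increase the pairing, so there is no
  descent.\<close>

lemma sorting_permutation:
  fixes \<alpha> :: "'p::{finite,linorder} \<Rightarrow> real"
  obtains \<pi> where "\<pi> permutes UNIV" "mono (\<alpha> \<circ> \<pi>)"
proof -
  define r where "r i = real (card {..i})" for i :: 'p
  have r_less: "r i < r j" if "i < j" for i j
    unfolding r_def of_nat_less_iff using that by (intro psubset_card_mono) auto
  define f where "f \<pi> = (\<Sum>i\<in>UNIV. \<alpha> (\<pi> i) * r i)" for \<pi>
  define P where "P = {\<pi>. \<pi> permutes (UNIV :: 'p set)}"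
  have fin: "finite (f ` P)" by simp
  have "f ` P \<noteq> {}" unfolding P_def using permutes_id[of UNIV] by blast
  then have "Max (f ` P) \<in> f ` P" by (rule Max_in[OF fin])
  then obtain \<pi> where \<pi>P: "\<pi> \<in> P" "Max (f ` P) = f \<pi>" by (rule imageE)
  then have \<pi>: "\<pi> permutes UNIV" by (simp add: P_def)
  have max: "f \<rho> \<le> f \<pi>" if "\<rho> permutes UNIV" for \<rho>
    unfolding \<pi>P(2)[symmetric] using that by (intro Max_ge[OF fin] imageI) (simp add: P_def)
  have "\<alpha> (\<pi> i) \<le> \<alpha> (\<pi> j)" if "i < j" for i j
  proof -
    define \<tau> where "\<tau> = Transposition.transpose i j"
    have "f (\<pi> \<circ> \<tau>) \<le> f \<pi>"
      using \<pi> by (intro max permutes_compose) (auto simp: \<tau>_def permutes_swap_id)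
    moreover have "f \<pi> - f (\<pi> \<circ> \<tau>) = (\<Sum>k\<in>{i,j}. \<alpha> (\<pi> k) * r k - \<alpha> (\<pi> (\<tau> k)) * r k)"
      unfolding f_def sum_subtractf[symmetric] o_def
      by (rule sum.mono_neutral_right) (auto simp: \<tau>_def transpose_def)
    moreover have "\<dots> = (\<alpha> (\<pi> j) - \<alpha> (\<pi> i)) * (r j - r i)"
      using that by (simp add: \<tau>_def algebra_simps)
    ultimately have "0 \<le> (\<alpha> (\<pi> j) - \<alpha> (\<pi> i)) * (r j - r i)" by linarith
    then show ?thesis using r_less[OF that] by (simp add: zero_le_mult_iff)
  qed
  then have "mono (\<alpha> \<circ> \<pi>)" by (intro monoI) (auto simp: le_less)
  with \<pi> show ?thesis by (rule that)
qed

text \<open>Dual solution of the assignment problem with payoff \<open>\<alpha> j * \<beta> k\<close>.\<close>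

lemma rearrangement_potentials:
  fixes \<alpha> \<beta> :: "'p::linorder \<Rightarrow> real"
  assumes "finite A" "mono \<alpha>" "mono \<beta>" "\<And>i. 0 \<le> \<alpha> i" "\<And>i. 0 \<le> \<beta> i"
  shows "\<exists>u v. (\<forall>j\<in>A. 0 \<le> u j \<and> 0 \<le> v j \<and> u j + v j = \<alpha> j * \<beta> j) \<and>
    (\<forall>j\<in>A. \<forall>k\<in>A. \<alpha> j * \<beta> k \<le> u j + v k)"
  using assms(1)
proof (induction rule: finite_linorder_max_induct)
  case empty
  then show ?case by simp
next
  case (insert b A)
  then obtain u v where uv: "\<forall>j\<in>A. 0 \<le> u j \<and> 0 \<le> v j \<and> u j + v j = \<alpha> j * \<beta> j"
    "\<forall>j\<in>A. \<forall>k\<in>A. \<alpha> j * \<beta> k \<le> u j + v k" by blast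
  show ?case
  proof (cases "A = {}")
    case True
    then show ?thesis
      using assms(4,5) by (intro exI[of _ "\<lambda>_. 0"] exI[of _ "\<lambda>_. \<alpha> b * \<beta> b"]) simp
  next
    case False
    define m where "m = Max A"
    have m: "m \<in> A" "\<And>j. j \<in> A \<Longrightarrow> j \<le> m" using False insert by (auto simp: m_def)
    have b: "b \<notin> A" using insert by auto
    have \<alpha>b: "\<alpha> j \<le> \<alpha> m" "\<beta> j \<le> \<beta> m" if "j \<in> A" for j
      using m(2)[OF that] assms(2,3) by (auto dest: monoD)
    have mb: "\<alpha> m \<le> \<alpha> b" "\<beta> m \<le> \<beta> b"
      using insert(2) m(1) assms(2,3) by (auto intro: monoD less_imp_le)
    \<comment> \<open>The values are forced by \<open>ub + vb = \<alpha> b * \<beta> b\<close> and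
      by tightness \<open>u m + vb = \<alpha> m * \<beta> b\<close> against the previous maximum
      \<open>m\<close>. The other constraints follow from those at \<open>m\<close> by
      monotonicity.\<close>
    define ub vb where "ub = u m + (\<alpha> b - \<alpha> m) * \<beta> b" and "vb = \<alpha> m * \<beta> b - u m"
    have um: "u m + v m = \<alpha> m * \<beta> m" "0 \<le> u m" "0 \<le> v m" using uv(1) m(1) by auto
    have ub: "0 \<le> ub" using um mb assms(5)[of b] by (simp add: ub_def)
    have "\<alpha> m * \<beta> m \<le> \<alpha> m * \<beta> b" using mb assms(4) by (intro mult_left_mono) auto
    then have vb: "0 \<le> vb" using um by (simp add: vb_def)
    have sum: "ub + vb = \<alpha> b * \<beta> b" by (simp add: ub_def vb_def algebra_simps)
    have 1: "\<alpha> j * \<beta> b \<le> u j + vb" if "j \<in> A" for j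
    proof -
      have "\<alpha> j * \<beta> m \<le> u j + v m" using uv(2) that m(1) by blast
      moreover have "(\<alpha> m - \<alpha> j) * \<beta> m \<le> (\<alpha> m - \<alpha> j) * \<beta> b"
        using \<alpha>b[OF that] mb by (intro mult_left_mono) auto
      ultimately show ?thesis using um by (simp add: vb_def algebra_simps)
    qed
    have 2: "\<alpha> b * \<beta> k \<le> ub + v k" if "k \<in> A" for k
    proof -
      have "\<alpha> m * \<beta> k \<le> u m + v k" using uv(2) that m(1) by blast
      moreover have "(\<alpha> b - \<alpha> m) * \<beta> k \<le> (\<alpha> b - \<alpha> m) * \<beta> b"
        using \<alpha>b[OF that] mb by (intro mult_left_mono) auto
      ultimately show ?thesis by (simp add: ub_def algebra_simps)
    qed
    show ?thesis
      using uv ub vb sum 1 2 b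
      by (intro exI[of _ "u(b := ub)"] exI[of _ "v(b := vb)"]) auto
  qed
qed

text \<open>Weak duality: the inequalities \<open>\<alpha> j * \<beta> k \<le> u j + v k\<close> are
  weighted by \<open>D\<close>; since the potentials are nonnegative, the bounds on row and column
  sums leave at most the sum of all \<open>u j + v j\<close>, the diagonal payoff.\<close>

lemma substochastic_rearrangement:
  fixes \<alpha> \<beta> :: "'p::{finite,linorder} \<Rightarrow> real"
  assumes "mono \<alpha>" "mono \<beta>" "\<And>i. 0 \<le> \<alpha> i" "\<And>i. 0 \<le> \<beta> i"
    and D: "\<And>j k. 0 \<le> D j k" "\<And>j. (\<Sum>k\<in>UNIV. D j k) \<le> 1" "\<And>k. (\<Sum>j\<in>UNIV. D j k) \<le> 1"
  shows "(\<Sum>j\<in>UNIV. \<Sum>k\<in>UNIV. \<alpha> j * \<beta> k * D j k) \<le> (\<Sum>j\<in>UNIV. \<alpha> j * \<beta> j)"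
proof -
  obtain u v where uv: "\<And>j. 0 \<le> u j" "\<And>j. 0 \<le> v j" "\<And>j. u j + v j = \<alpha> j * \<beta> j"
    "\<And>j k. \<alpha> j * \<beta> k \<le> u j + v k"
    using rearrangement_potentials[OF finite assms(1-4), of UNIV] by auto
  have "(\<Sum>j\<in>UNIV. \<Sum>k\<in>UNIV. \<alpha> j * \<beta> k * D j k) \<le> (\<Sum>j\<in>UNIV. \<Sum>k\<in>UNIV. (u j + v k) * D j k)"
    by (intro sum_mono mult_right_mono uv D)
  also have "\<dots> = (\<Sum>j\<in>UNIV. u j * (\<Sum>k\<in>UNIV. D j k)) + (\<Sum>j\<in>UNIV. \<Sum>k\<in>UNIV. v k * D j k)"
    by (simp add: algebra_simps sum.distrib sum_distrib_left)
  also have "(\<Sum>j\<in>UNIV. \<Sum>k\<in>UNIV. v k * D j k) = (\<Sum>k\<in>UNIV. v k * (\<Sum>j\<in>UNIV. D j k))"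
    by (subst sum.swap) (simp add: sum_distrib_left)
  also have "(\<Sum>j\<in>UNIV. u j * (\<Sum>k\<in>UNIV. D j k)) + \<dots> \<le> (\<Sum>j\<in>UNIV. u j * 1) + (\<Sum>k\<in>UNIV. v k * 1)"
    by (intro add_mono sum_mono mult_left_mono uv D)
  also have "\<dots> = (\<Sum>j\<in>UNIV. \<alpha> j * \<beta> j)" by (simp add: uv(3) flip: sum.distrib)
  finally show ?thesis .
qed

lemma finite_Wp_orbit: "finite (Wp_orbit (x :: real^'p))"
proof (rule finite_subset)
  \<comment> \<open>Signs are recoded as booleans, so that the orbit is covered by the image of a
    finite type.\<close>
  show "Wp_orbit x \<subseteq> range (\<lambda>(\<sigma> :: 'p \<Rightarrow> 'p, e). \<chi> i. (if e i then 1 else -1) * x$(\<sigma> i))"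
  proof
    fix z assume "z \<in> Wp_orbit x"
    then obtain \<sigma> \<epsilon> where "z = (\<chi> i. \<epsilon> i * x$(\<sigma> i))" and \<epsilon>: "\<forall>i. \<epsilon> i = 1 \<or> \<epsilon> i = -1"
      by (auto simp: Wp_orbit_def)
    then have "z = (\<chi> i. (if \<epsilon> i = 1 then 1 else -1) * x$(\<sigma> i))"
      by (simp add: vec_eq_iff) (metis mult_1 mult_minus1)
    then show "z \<in> range (\<lambda>(\<sigma> :: 'p \<Rightarrow> 'p, e). \<chi> i. (if e i then 1 else -1) * x$(\<sigma> i))"
      by (intro range_eqI[of _ _ "(\<sigma>, \<lambda>i. \<epsilon> i = 1)"]) simp
  qed
qed simp

text \<open>By rearrangement, a substochastic \<open>D\<close> can do no better than pair the sorted
  absolute values of \<open>a\<close> with the sorted \<open>\<psi>\<close>, and this optimum is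
  attained at a signed permutation of \<open>\<psi>\<close>, where \<open>B\<close> is a
  bound.\<close>

lemma substochastic_le_orbit_support:
  fixes a c \<psi> :: "real^('p::{finite,linorder})"
  assumes \<psi>: "\<And>i. 0 \<le> \<psi>$i" "\<And>i j. i \<le> j \<Longrightarrow> \<psi>$i \<le> \<psi>$j"
    and B: "\<And>z. z \<in> Wp_orbit \<psi> \<Longrightarrow> a \<bullet> z \<le> B"
    and D: "\<And>j k. 0 \<le> D j k" "\<And>j. (\<Sum>k\<in>UNIV. D j k) \<le> 1" "\<And>k. (\<Sum>j\<in>UNIV. D j k) \<le> 1"
    and c: "\<And>j. \<bar>c$j\<bar> \<le> (\<Sum>k\<in>UNIV. D j k * \<psi>$k)"
  shows "a \<bullet> c \<le> B"
proof -
  define \<alpha> where "\<alpha> j = \<bar>a$j\<bar>" for j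
  obtain \<pi> where \<pi>: "\<pi> permutes UNIV" "mono (\<alpha> \<circ> \<pi>)" by (rule sorting_permutation)
  have bij: "bij \<pi>" using \<pi>(1) by (rule permutes_bij)
  \<comment> \<open>\<open>inv \<pi>\<close> matches the order of \<open>\<psi>\<close> to that of
    \<open>\<bar>a$j\<bar>\<close>, and the signs of \<open>a\<close> make every term of
    \<open>a \<bullet> z\<close> nonnegative.\<close>
  define z where "z = (\<chi> j. (if 0 \<le> a$j then 1 else -1) * \<psi>$(inv \<pi> j))"
  have "z \<in> Wp_orbit \<psi>"
    unfolding Wp_orbit_def z_def mem_Collect_eq
    by (rule exI[of _ "inv \<pi>"], rule exI[of _ "\<lambda>j. if 0 \<le> a$j then 1 else -1"])
      (use permutes_inv[OF \<pi>(1)] in simp)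
  have "a \<bullet> c \<le> (\<Sum>j\<in>UNIV. \<alpha> j * (\<Sum>k\<in>UNIV. D j k * \<psi>$k))"
    unfolding inner_vec_def inner_real_def
  proof (rule sum_mono)
    fix j
    have "a$j * c$j \<le> \<bar>a$j\<bar> * \<bar>c$j\<bar>" by (metis abs_ge_self abs_mult)
    also have "\<dots> \<le> \<alpha> j * (\<Sum>k\<in>UNIV. D j k * \<psi>$k)"
      unfolding \<alpha>_def by (intro mult_left_mono c) simp
    finally show "a$j * c$j \<le> \<alpha> j * (\<Sum>k\<in>UNIV. D j k * \<psi>$k)" .
  qed
  also have "\<dots> = (\<Sum>i\<in>UNIV. \<alpha> (\<pi> i) * (\<Sum>k\<in>UNIV. D (\<pi> i) k * \<psi>$k))"
    by (rule sum.reindex_bij_betw[OF bij, symmetric])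
  also have "\<dots> = (\<Sum>i\<in>UNIV. \<Sum>k\<in>UNIV. (\<alpha> \<circ> \<pi>) i * \<psi>$k * D (\<pi> i) k)"
    by (simp add: sum_distrib_left mult_ac)
  also have "\<dots> \<le> (\<Sum>i\<in>UNIV. (\<alpha> \<circ> \<pi>) i * \<psi>$i)"
  proof (rule substochastic_rearrangement[OF \<pi>(2)])
    show "mono (($) \<psi>)" using \<psi>(2) by (rule monoI)
    show "(\<Sum>j\<in>UNIV. D (\<pi> j) k) \<le> 1" for k
      using D(3)[of k] by (simp add: sum.reindex_bij_betw[OF bij, of "\<lambda>j. D j k"])
  qed (use \<psi> D in \<open>auto simp: \<alpha>_def\<close>)
  also have "\<dots> = (\<Sum>j\<in>UNIV. \<alpha> j * \<psi>$(inv \<pi> j))"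
    using sum.reindex_bij_betw[OF bij, of "\<lambda>j. \<alpha> j * \<psi>$(inv \<pi> j)"] permutes_inverses(2)[OF \<pi>(1)] by simp
  also have "\<dots> = a \<bullet> z"
    unfolding inner_vec_def inner_real_def by (rule sum.cong) (auto simp: z_def \<alpha>_def)
  also have "\<dots> \<le> B" by (rule B) fact
  finally show ?thesis .
qed

section \<open>Variation of the angles along a path\<close>

text \<open>Only \<open>x'$j \<bullet> x$j\<close> and \<open>v'$j \<bullet> v$j\<close> survive;
  antisymmetrising gives both the same coefficient, which the addition formula turns into the sine
  of the angle increment.\<close>

lemma frame_identity:
  assumes "angle_frame L M x v \<theta>" "angle_frame L M' x' v' \<theta>'"
  shows "frame_base x' v' \<theta>' $ j \<bullet> frame_normal x v \<theta> $ j - frame_normal x' v' \<theta>' $ j \<bullet> frame_base x v \<theta> $ j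
    = - sin (\<theta>'$j - \<theta>$j) * (x'$j \<bullet> x$j + v'$j \<bullet> v$j)"
proof -
  have "x'$j \<bullet> v$j = 0" "v'$j \<bullet> x$j = 0"
    using assms inner_orthogonal_comp[of "x'$j" L "v$j"] inner_orthogonal_comp[of "x$j" L "v'$j"]
    by (auto simp: angle_frame_def inner_commute)
  then show ?thesis
    by (simp add: frame_base_def frame_normal_def inner_add_left inner_add_right inner_diff_left
        inner_diff_right sin_diff algebra_simps)
qed

lemma orthonormal_limit:
  fixes X :: "nat \<Rightarrow> real^'n^'p"
  assumes "\<And>i. orthonormal (X i)" "X \<longlonglongrightarrow> x"
  shows "orthonormal x"
  unfolding orthonormal_def
proof (intro allI)
  fix a b
  have "(\<lambda>i. X i $ a \<bullet> X i $ b) \<longlonglongrightarrow> x $ a \<bullet> x $ b"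
    by (intro tendsto_intros assms)
  then have "(\<lambda>i::nat. if a = b then 1 else 0 :: real) \<longlonglongrightarrow> x $ a \<bullet> x $ b"
    by (simp only: orthonormal_inner[OF assms(1)])
  then show "x $ a \<bullet> x $ b = (if a = b then 1 else 0)"
    by (rule LIMSEQ_unique[OF _ tendsto_const])
qed

lemma tendsto_frame_base:
  assumes "X \<longlonglongrightarrow> x" "V \<longlonglongrightarrow> v" "\<Theta> \<longlonglongrightarrow> \<theta>"
  shows "(\<lambda>i. frame_base (X i) (V i) (\<Theta> i) $ j) \<longlonglongrightarrow> frame_base x v \<theta> $ j"
  unfolding frame_base_def combine_nth by (intro tendsto_intros assms)

lemma tendsto_frame_normal:
  assumes "X \<longlonglongrightarrow> x" "V \<longlonglongrightarrow> v" "\<Theta> \<longlonglongrightarrow> \<theta>"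
  shows "(\<lambda>i. frame_normal (X i) (V i) (\<Theta> i) $ j) \<longlonglongrightarrow> frame_normal x v \<theta> $ j"
  unfolding frame_normal_def combine_nth by (intro tendsto_intros assms)

text \<open>The conditions are closed, but the subspace varies; membership is therefore written as
  the expansion in the orthonormal rows of \<open>m i\<close>, which passes to the limit.\<close>

lemma angle_frame_limit:
  fixes m X V :: "nat \<Rightarrow> real^'n^('p::{finite,linorder})"
  assumes L: "subspace L"
    and m: "\<And>i. orthonormal (m i)" "m \<longlonglongrightarrow> m0"
    and frame: "\<And>i. angle_frame L (span (range (\<lambda>k. m i $ k))) (X i) (V i) (\<Theta> i)"
    and lim: "X \<longlonglongrightarrow> x" "V \<longlonglongrightarrow> v" "\<Theta> \<longlonglongrightarrow> \<theta>"
  shows "angle_frame L (span (range (\<lambda>k. m0 $ k))) x v \<theta>"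
  unfolding angle_frame_def
proof (intro conjI allI impI)
  have f: "orthonormal (X i)" "X i $ k \<in> L" "orthonormal (V i)" "V i $ k \<in> orthogonal_comp L"
    "0 \<le> \<Theta> i $ k" "\<Theta> i $ k \<le> pi/2" "k \<le> l \<Longrightarrow> \<Theta> i $ k \<le> \<Theta> i $ l" for i k l
    using frame[of i] by (auto simp: angle_frame_def)
  show "orthonormal x" "orthonormal v"
    using orthonormal_limit[of X] orthonormal_limit[of V] f lim by blast+
  fix k l
  have X_lim: "(\<lambda>i. X i $ k) \<longlonglongrightarrow> x $ k" and V_lim: "(\<lambda>i. V i $ k) \<longlonglongrightarrow> v $ k"
    and T_lim: "(\<lambda>i. \<Theta> i $ k) \<longlonglongrightarrow> \<theta> $ k" "(\<lambda>i. \<Theta> i $ l) \<longlonglongrightarrow> \<theta> $ l"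
    by (intro tendsto_intros lim)+
  show "x $ k \<in> L" using closed_subspace[OF L] f(2) X_lim by (rule closed_sequentially)
  show "v $ k \<in> orthogonal_comp L"
    using closed_subspace[OF subspace_orthogonal_comp] f(4) V_lim by (rule closed_sequentially)
  show "0 \<le> \<theta> $ k" using T_lim(1) f(5) by (auto intro: LIMSEQ_le_const)
  show "\<theta> $ k \<le> pi/2" by (rule LIMSEQ_le_const2[OF T_lim(1)]) (use f(6) in blast)
  show "\<theta> $ k \<le> \<theta> $ l" if "k \<le> l"
    using T_lim f(7)[OF that] by (auto intro: LIMSEQ_le)
  define Y where "Y i = frame_base (X i) (V i) (\<Theta> i) $ k" for i
  define y where "y = frame_base x v \<theta> $ k"
  have Y_lim: "Y \<longlonglongrightarrow> y" unfolding Y_def y_def by (rule tendsto_frame_base[OF lim])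
  have "Y i = (\<Sum>l\<in>UNIV. (Y i \<bullet> m i $ l) *\<^sub>R m i $ l)" for i
    unfolding Y_def by (rule orthonormal_expansion[OF m(1) frame_base_in[OF frame]])
  moreover have "(\<lambda>i. \<Sum>l\<in>UNIV. (Y i \<bullet> m i $ l) *\<^sub>R m i $ l) \<longlonglongrightarrow> (\<Sum>l\<in>UNIV. (y \<bullet> m0 $ l) *\<^sub>R m0 $ l)"
    by (intro tendsto_intros Y_lim m)
  ultimately have "Y \<longlonglongrightarrow> (\<Sum>l\<in>UNIV. (y \<bullet> m0 $ l) *\<^sub>R m0 $ l)" by simp
  then have "y = (\<Sum>l\<in>UNIV. (y \<bullet> m0 $ l) *\<^sub>R m0 $ l)" using Y_lim LIMSEQ_unique by blast
  also have "\<dots> \<in> span (range (\<lambda>k. m0 $ k))"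
    by (intro span_sum span_mul span_base) simp
  finally show "cos (\<theta>$k) *\<^sub>R x$k + sin (\<theta>$k) *\<^sub>R v$k \<in> span (range (\<lambda>k. m0 $ k))"
    by (simp add: y_def frame_base_def)
qed

text \<open>By \<open>frame_identity\<close> the sine of the angle increment, times a factor tending
  to 2, is an antisymmetric expression in old and new frames. Normals annihilate their own
  subspaces, so this expression sees only increments of the curve: the frames need to converge, not
  to be differentiable.\<close>

lemma angle_quotient_limit:
  fixes m X V :: "nat \<Rightarrow> real^'n^('p::{finite,linorder})" and \<delta> :: "nat \<Rightarrow> real"
  assumes L: "subspace L"
    and m: "\<And>i. orthonormal (m i)" "m \<longlonglongrightarrow> m0"
    and \<delta>: "\<And>i. \<delta> i \<noteq> 0"
    and quot: "\<And>k. (\<lambda>i. (m i $ k - m0 $ k) /\<^sub>R \<delta> i) \<longlonglongrightarrow> \<psi>$k *\<^sub>R n$k"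
    and frame: "\<And>i. angle_frame L (span (range (\<lambda>k. m i $ k))) (X i) (V i) (\<Theta> i)"
    and lim: "X \<longlonglongrightarrow> x" "V \<longlonglongrightarrow> v" "\<Theta> \<longlonglongrightarrow> \<theta>"
  shows "(\<lambda>i. (\<Theta> i $ j - \<theta> $ j) / \<delta> i) \<longlonglongrightarrow>
    - (\<Sum>k\<in>UNIV. (frame_base x v \<theta> $ j \<bullet> m0 $ k) * (n $ k \<bullet> frame_normal x v \<theta> $ j) * \<psi>$k)"
    (is "_ \<longlonglongrightarrow> - ?S")
proof -
  have m0: "orthonormal m0" by (rule orthonormal_limit[OF m])
  have frame0: "angle_frame L (span (range (\<lambda>k. m0 $ k))) x v \<theta>"
    by (rule angle_frame_limit[OF L m frame lim])
  define Y W where "Y i = frame_base (X i) (V i) (\<Theta> i) $ j" and "W i = frame_normal (X i) (V i) (\<Theta> i) $ j" for i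
  define y w where "y = frame_base x v \<theta> $ j" and "w = frame_normal x v \<theta> $ j"
  define q where "q k i = (m i $ k - m0 $ k) /\<^sub>R \<delta> i" for k i
  have q_lim: "q k \<longlonglongrightarrow> \<psi>$k *\<^sub>R n$k" for k unfolding q_def by (rule quot)
  have Y_lim: "Y \<longlonglongrightarrow> y" unfolding Y_def y_def by (rule tendsto_frame_base[OF lim])
  have W_lim: "W \<longlonglongrightarrow> w" unfolding W_def w_def by (rule tendsto_frame_normal[OF lim])
  have step: "m i $ k = m0 $ k + \<delta> i *\<^sub>R q k i" for i k using \<delta> by (simp add: q_def)
  have w_perp: "w \<bullet> m0 $ k = 0" for k
    unfolding w_def
    by (rule frame_normal_orthogonal[OF frame0]) (auto intro: span_base simp: orthonormal_dim[OF m0])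
  have W_perp: "W i \<bullet> m i $ k = 0" for i k
    unfolding W_def
    by (rule frame_normal_orthogonal[OF frame]) (auto intro: span_base simp: orthonormal_dim[OF m(1)])
  define A where "A i = (\<Sum>k\<in>UNIV. (Y i \<bullet> m i $ k) * (q k i \<bullet> w)) + (\<Sum>k\<in>UNIV. (y \<bullet> m0 $ k) * (W i \<bullet> q k i))" for i
  \<comment> \<open>Both sums converge to \<open>?S\<close>; the factor 2 is later cancelled by the
    limit of \<open>T\<close>.\<close>
  have "A \<longlonglongrightarrow> (\<Sum>k\<in>UNIV. (y \<bullet> m0 $ k) * ((\<psi>$k *\<^sub>R n$k) \<bullet> w))
      + (\<Sum>k\<in>UNIV. (y \<bullet> m0 $ k) * (w \<bullet> (\<psi>$k *\<^sub>R n$k)))"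
    unfolding A_def by (intro tendsto_intros Y_lim W_lim q_lim m)
  moreover have "(\<Sum>k\<in>UNIV. (y \<bullet> m0 $ k) * ((\<psi>$k *\<^sub>R n$k) \<bullet> w))
      + (\<Sum>k\<in>UNIV. (y \<bullet> m0 $ k) * (w \<bullet> (\<psi>$k *\<^sub>R n$k))) = 2 * ?S"
    by (simp add: y_def w_def inner_commute mult_ac)
  ultimately have A_lim: "A \<longlonglongrightarrow> 2 * ?S" by (simp only:)
  \<comment> \<open>\<open>w\<close> is orthogonal to the limit subspace and \<open>W i\<close> to
    the one at step \<open>i\<close>, so each inner product with a basis vector of the other
    subspace reduces to the increment \<open>\<delta> i *\<^sub>R q k i\<close>.\<close>
  have A_eq: "Y i \<bullet> w - W i \<bullet> y = \<delta> i * A i" for i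
  proof -
    have "Y i = (\<Sum>k\<in>UNIV. (Y i \<bullet> m i $ k) *\<^sub>R m i $ k)"
      unfolding Y_def by (rule orthonormal_expansion[OF m(1) frame_base_in[OF frame]])
    then have "Y i \<bullet> w = (\<Sum>k\<in>UNIV. (Y i \<bullet> m i $ k) *\<^sub>R m i $ k) \<bullet> w" by simp
    also have "\<dots> = (\<Sum>k\<in>UNIV. (Y i \<bullet> m i $ k) * (m i $ k \<bullet> w))" by (simp add: inner_sum_left)
    also have "\<dots> = (\<Sum>k\<in>UNIV. \<delta> i * ((Y i \<bullet> m i $ k) * (q k i \<bullet> w)))"
    proof (rule sum.cong)
      fix k
      have "m i $ k \<bullet> w = \<delta> i * (q k i \<bullet> w)"
        using w_perp[of k] by (simp add: step[of i k] inner_add_left inner_commute[of _ w] inner_add_right)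
      then show "(Y i \<bullet> m i $ k) * (m i $ k \<bullet> w) = \<delta> i * ((Y i \<bullet> m i $ k) * (q k i \<bullet> w))" by simp
    qed simp
    finally have 1: "Y i \<bullet> w = \<delta> i * (\<Sum>k\<in>UNIV. (Y i \<bullet> m i $ k) * (q k i \<bullet> w))"
      by (simp add: sum_distrib_left)
    have "y = (\<Sum>k\<in>UNIV. (y \<bullet> m0 $ k) *\<^sub>R m0 $ k)"
      unfolding y_def by (rule orthonormal_expansion[OF m0 frame_base_in[OF frame0]])
    then have "W i \<bullet> y = W i \<bullet> (\<Sum>k\<in>UNIV. (y \<bullet> m0 $ k) *\<^sub>R m0 $ k)" by simp
    also have "\<dots> = (\<Sum>k\<in>UNIV. (y \<bullet> m0 $ k) * (W i \<bullet> m0 $ k))" by (simp add: inner_sum_right)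
    also have "\<dots> = (\<Sum>k\<in>UNIV. - \<delta> i * ((y \<bullet> m0 $ k) * (W i \<bullet> q k i)))"
    proof (rule sum.cong)
      fix k
      have "W i \<bullet> m0 $ k = - \<delta> i * (W i \<bullet> q k i)"
        using W_perp[of i k] by (simp add: step inner_add_right)
      then show "(y \<bullet> m0 $ k) * (W i \<bullet> m0 $ k) = - \<delta> i * ((y \<bullet> m0 $ k) * (W i \<bullet> q k i))" by simp
    qed simp
    finally have 2: "W i \<bullet> y = - \<delta> i * (\<Sum>k\<in>UNIV. (y \<bullet> m0 $ k) * (W i \<bullet> q k i))"
      by (simp add: sum_distrib_left)
    show ?thesis unfolding 1 2 A_def by (simp add: algebra_simps)
  qed
  define T where "T i = X i $ j \<bullet> x $ j + V i $ j \<bullet> v $ j" for i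
  have "T \<longlonglongrightarrow> x $ j \<bullet> x $ j + v $ j \<bullet> v $ j"
    unfolding T_def by (intro tendsto_intros lim)
  then have T_lim: "T \<longlonglongrightarrow> 2"
    using frame0 by (simp add: angle_frame_def orthonormal_inner)
  define u where "u i = sin (\<Theta> i $ j - \<theta> $ j)" for i
  have uT: "u i * T i = - \<delta> i * A i" for i
    using frame_identity[OF frame0 frame[of i], of j] A_eq[of i]
    by (simp add: u_def T_def Y_def W_def y_def w_def)
  have "(\<lambda>i. - A i / T i) \<longlonglongrightarrow> - (2 * ?S) / 2"
    by (intro tendsto_intros A_lim T_lim) simp
  moreover have "\<forall>\<^sub>F i in sequentially. 0 < T i"
    using order_tendstoD(1)[OF T_lim, of 0] by simp
  then have "\<forall>\<^sub>F i in sequentially. - A i / T i = u i / \<delta> i"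
  proof eventually_elim
    case (elim i)
    then show ?case using uT[of i] \<delta>[of i] by (simp add: field_simps)
  qed
  ultimately have quot_u: "(\<lambda>i. u i / \<delta> i) \<longlonglongrightarrow> - ?S"
    by (auto intro: Lim_transform_eventually)
  have "u \<longlonglongrightarrow> sin (\<theta> $ j - \<theta> $ j)"
    unfolding u_def by (intro tendsto_intros lim)
  then have u_lim: "u \<longlonglongrightarrow> 0" by simp
  \<comment> \<open>The passage from sine to angle uses Caratheodory's form
    \<open>arcsin z = g z * z\<close>, which stays valid when \<open>u i\<close> is 0.\<close>
  have "DERIV arcsin 0 :> 1" using DERIV_arcsin[of 0] by simp
  then obtain g where g: "\<And>z. arcsin z = g z * z" "isCont g 0" "g 0 = 1"
    unfolding CARAT_DERIV by auto
  have ang: "0 \<le> \<Theta> i $ j" "\<Theta> i $ j \<le> pi/2" "0 \<le> \<theta> $ j" "\<theta> $ j \<le> pi/2" for i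
    using frame[of i] frame0 by (auto simp: angle_frame_def)
  have "(\<Theta> i $ j - \<theta> $ j) / \<delta> i = g (u i) * (u i / \<delta> i)" for i
  proof -
    have "\<Theta> i $ j - \<theta> $ j = arcsin (u i)"
      unfolding u_def using ang(1,2)[of i] ang(3,4) by (intro arcsin_sin[symmetric]) linarith+
    then show ?thesis using g(1)[of "u i"] by simp
  qed
  moreover have "(\<lambda>i. g (u i) * (u i / \<delta> i)) \<longlonglongrightarrow> g 0 * - ?S"
    by (intro tendsto_mult quot_u isCont_tendsto_compose[OF g(2)] u_lim)
  ultimately show ?thesis by (simp only: g(3) mult_1)
qed

text \<open>The inequality \<open>\<bar>p * q\<bar> \<le> (p\<^sup>2 + q\<^sup>2) / 2\<close>
  separates the two factors: \<open>D\<close> averages two matrices of squared inner products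
  between orthonormal families, and Bessel bounds the row and column sums of each by 1.\<close>

lemma angle_velocity_le:
  fixes y m n w :: "real^'n^('p::{finite,linorder})" and a \<psi> :: "real^('p::{finite,linorder})"
  assumes ON: "orthonormal y" "orthonormal m" "orthonormal n" "orthonormal w"
    and \<psi>: "\<And>i. 0 \<le> \<psi>$i" "\<And>i j. i \<le> j \<Longrightarrow> \<psi>$i \<le> \<psi>$j"
    and B: "\<And>z. z \<in> Wp_orbit \<psi> \<Longrightarrow> a \<bullet> z \<le> B"
  shows "a \<bullet> (\<chi> j. - (\<Sum>k\<in>UNIV. (y $ j \<bullet> m $ k) * (n $ k \<bullet> w $ j) * \<psi>$k)) \<le> B"
proof -
  define D where "D j k = ((y $ j \<bullet> m $ k)\<^sup>2 + (n $ k \<bullet> w $ j)\<^sup>2) / 2" for j k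
  have bes: "(\<Sum>k\<in>UNIV. (X $ j \<bullet> Z $ k)\<^sup>2) \<le> 1" if "orthonormal X" "orthonormal Z"
    for X Z :: "real^'n^('p::{finite,linorder})" and j
    using bessel_inequality[OF that(2), of "X $ j"] orthonormal_inner[OF that(1), of j j] by simp
  show ?thesis
  proof (rule substochastic_le_orbit_support[OF \<psi> B])
    show "0 \<le> D j k" for j k by (simp add: D_def)
    show "(\<Sum>k\<in>UNIV. D j k) \<le> 1" for j
      using bes[OF ON(1,2), of j] bes[OF ON(4,3), of j]
      by (simp add: D_def add_divide_distrib sum.distrib inner_commute flip: sum_divide_distrib)
    show "(\<Sum>j\<in>UNIV. D j k) \<le> 1" for k
      using bes[OF ON(2,1), of k] bes[OF ON(3,4), of k]
      by (simp add: D_def add_divide_distrib sum.distrib inner_commute flip: sum_divide_distrib)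
    fix j
    have "\<bar>\<Sum>k\<in>UNIV. (y $ j \<bullet> m $ k) * (n $ k \<bullet> w $ j) * \<psi>$k\<bar>
      \<le> (\<Sum>k\<in>UNIV. \<bar>(y $ j \<bullet> m $ k) * (n $ k \<bullet> w $ j) * \<psi>$k\<bar>)" by (rule sum_abs)
    also have "\<dots> \<le> (\<Sum>k\<in>UNIV. D j k * \<psi>$k)"
    proof (rule sum_mono)
      fix k
      have "\<bar>p * q\<bar> \<le> (p\<^sup>2 + q\<^sup>2) / 2" for p q :: real
        using sum_squares_bound[of "\<bar>p\<bar>" "\<bar>q\<bar>"] by (simp add: abs_mult)
      then show "\<bar>(y $ j \<bullet> m $ k) * (n $ k \<bullet> w $ j) * \<psi>$k\<bar> \<le> D j k * \<psi>$k"
        unfolding D_def abs_mult[of _ "\<psi>$k"] using \<psi>(1)[of k] by (intro mult_mono) auto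
    qed
    finally show "\<bar>(\<chi> j. - (\<Sum>k\<in>UNIV. (y $ j \<bullet> m $ k) * (n $ k \<bullet> w $ j) * \<psi>$k)) $ j\<bar>
      \<le> (\<Sum>k\<in>UNIV. D j k * \<psi>$k)" by simp
  qed
qed

text \<open>Differentiability of the angles is avoided: times violating the bound and tending to
  \<open>t0\<close> would have a subsequence with convergent frames, along which the quotients tend
  to a vector controlled by \<open>angle_velocity_le\<close>. The slack \<open>\<epsilon>\<close>
  makes the contradiction strict.\<close>

lemma jordan_angles_local_bound:
  fixes m :: "real \<Rightarrow> real^'n^('p::{finite,linorder})" and a \<psi> :: "real^('p::{finite,linorder})"
  assumes pq: "CARD('p) \<le> CARD('n) - CARD('p)"
    and L: "subspace L" "dim L = CARD('p)"
    and m: "\<And>t. orthonormal (m t)" "isCont m t0"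
    and n: "orthonormal n"
    and quot: "\<And>k. ((\<lambda>t. (m t $ k - m t0 $ k) /\<^sub>R (t - t0)) \<longlongrightarrow> \<psi>$k *\<^sub>R n$k) (at t0)"
    and \<psi>: "\<And>i. 0 \<le> \<psi>$i" "\<And>i j. i \<le> j \<Longrightarrow> \<psi>$i \<le> \<psi>$j"
    and B: "\<And>z. z \<in> Wp_orbit \<psi> \<Longrightarrow> a \<bullet> z \<le> B"
    and "0 < \<epsilon>"
  defines "\<theta> \<equiv> \<lambda>t. jordan_angles L (span (range (\<lambda>k. m t $ k)))"
  shows "\<exists>d>0. \<forall>t. t \<noteq> t0 \<longrightarrow> \<bar>t - t0\<bar> < d \<longrightarrow> (a \<bullet> (\<theta> t - \<theta> t0)) / (t - t0) < B + \<epsilon>"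
proof (rule ccontr)
  assume "\<not> ?thesis"
  then have "\<forall>i::nat. \<exists>t. t \<noteq> t0 \<and> \<bar>t - t0\<bar> < inverse (real (Suc i)) \<and> B + \<epsilon> \<le> (a \<bullet> (\<theta> t - \<theta> t0)) / (t - t0)"
    by (metis inverse_positive_iff_positive not_less of_nat_0_less_iff zero_less_Suc)
  then obtain \<tau> where \<tau>: "\<And>i. \<tau> i \<noteq> t0" "\<And>i. \<bar>\<tau> i - t0\<bar> < inverse (real (Suc i))"
    "\<And>i. B + \<epsilon> \<le> (a \<bullet> (\<theta> (\<tau> i) - \<theta> t0)) / (\<tau> i - t0)" by metis
  have "(\<lambda>i. \<tau> i - t0) \<longlonglongrightarrow> 0"
    by (rule Lim_null_comparison[OF _ LIMSEQ_inverse_real_of_nat])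
      (use \<tau>(2) in \<open>auto intro!: always_eventually less_imp_le\<close>)
  then have \<tau>_lim: "\<tau> \<longlonglongrightarrow> t0" by (simp add: LIM_zero_iff)
  let ?M = "\<lambda>t. span (range (\<lambda>k. m t $ k))"
  have M: "subspace (?M t)" "dim (?M t) = CARD('p)" for t
    by (simp_all add: orthonormal_dim[OF m(1)])
  have "\<exists>x v \<phi>. angle_frame L (?M (\<tau> i)) x v (\<phi> :: real^('p::{finite,linorder}))" for i
    using angle_frame_exists[OF pq L M] by metis
  then obtain X V :: "nat \<Rightarrow> real^'n^('p::{finite,linorder})" and \<Theta>
    where frame: "\<And>i. angle_frame L (?M (\<tau> i)) (X i) (V i) (\<Theta> i)" by metis
  \<comment> \<open>Frames are not unique and may jump with time, but all lie in one compact set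
    depending only on \<open>L\<close>.\<close>
  define K where "K = {X :: real^'n^('p::{finite,linorder}). orthonormal X \<and> (\<forall>i. X$i \<in> L)} \<times>
    {X :: real^'n^('p::{finite,linorder}). orthonormal X \<and> (\<forall>i. X$i \<in> orthogonal_comp L)} \<times> cbox (0 :: real^('p::{finite,linorder})) (\<chi> i. pi/2)"
  have K: "compact K"
    unfolding K_def by (intro compact_Times compact_orthonormal_families L subspace_orthogonal_comp compact_cbox)
  have inK: "\<forall>i. (X i, V i, \<Theta> i) \<in> K"
    using frame by (auto simp: K_def angle_frame_def mem_box_cart)
  obtain l r where r_lim: "strict_mono r" "((\<lambda>i. (X i, V i, \<Theta> i)) \<circ> r) \<longlonglongrightarrow> l"
    using K[unfolded compact_def, THEN spec, THEN mp, OF inK] by (elim bexE exE conjE)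
  obtain x v \<phi> where "l = (x, v, \<phi>)" by (rule prod_cases3)
  with r_lim have r: "strict_mono r" "((\<lambda>i. (X i, V i, \<Theta> i)) \<circ> r) \<longlonglongrightarrow> (x, v, \<phi>)" by simp_all
  have lim: "(X \<circ> r) \<longlonglongrightarrow> x" "(V \<circ> r) \<longlonglongrightarrow> v" "(\<Theta> \<circ> r) \<longlonglongrightarrow> \<phi>"
    using tendsto_fst[OF r(2)] tendsto_fst[OF tendsto_snd[OF r(2)]] tendsto_snd[OF tendsto_snd[OF r(2)]]
    by (simp_all add: o_def)
  have \<tau>r: "(\<tau> \<circ> r) \<longlonglongrightarrow> t0" by (rule LIMSEQ_subseq_LIMSEQ[OF \<tau>_lim r(1)])
  then have \<tau>r_at: "filterlim (\<tau> \<circ> r) (at t0) sequentially"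
    using \<tau>(1) by (intro filterlim_atI) auto
  have m_lim: "(\<lambda>i. m (\<tau> (r i))) \<longlonglongrightarrow> m t0"
    using isCont_tendsto_compose[OF m(2) \<tau>r] by (simp add: o_def)
  have q_lim: "(\<lambda>i. (m (\<tau> (r i)) $ k - m t0 $ k) /\<^sub>R (\<tau> (r i) - t0)) \<longlonglongrightarrow> \<psi>$k *\<^sub>R n$k" for k
    using filterlim_compose[OF quot[of k] \<tau>r_at] by (simp add: o_def)
  have frame_r: "angle_frame L (?M (\<tau> (r i))) ((X \<circ> r) i) ((V \<circ> r) i) ((\<Theta> \<circ> r) i)" for i
    using frame by simp
  have frame0: "angle_frame L (?M t0) x v \<phi>"
    by (rule angle_frame_limit[OF L(1) m(1) m_lim frame_r lim])
  \<comment> \<open>Whichever frame arises as the limit, its angles are the Jordan angles at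
    \<open>t0\<close>.\<close>
  have \<theta>0: "\<theta> t0 = \<phi>"
    unfolding \<theta>_def by (rule angle_frame_jordan_angles[OF frame0 L M])
  have \<theta>r: "\<theta> (\<tau> (r i)) = \<Theta> (r i)" for i
    unfolding \<theta>_def by (rule angle_frame_jordan_angles[OF frame L M])
  define c where "c = (\<chi> j. - (\<Sum>k\<in>UNIV. (frame_base x v \<phi> $ j \<bullet> m t0 $ k) *
    (n $ k \<bullet> frame_normal x v \<phi> $ j) * \<psi>$k))"
  have "(\<lambda>i. (\<Theta> (r i) $ j - \<phi> $ j) / (\<tau> (r i) - t0)) \<longlonglongrightarrow> c $ j" for j
    using angle_quotient_limit[OF L(1) m(1) m_lim _ q_lim frame_r lim, of j] \<tau>(1)
    by (simp add: c_def)
  then have "(\<lambda>i. \<Sum>j\<in>UNIV. a$j * ((\<Theta> (r i) $ j - \<phi> $ j) / (\<tau> (r i) - t0))) \<longlonglongrightarrow> (\<Sum>j\<in>UNIV. a$j * c$j)"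
    by (intro tendsto_intros)
  moreover have "(\<Sum>j\<in>UNIV. a$j * ((\<Theta> (r i) $ j - \<phi> $ j) / (\<tau> (r i) - t0)))
    = (a \<bullet> (\<theta> (\<tau> (r i)) - \<theta> t0)) / (\<tau> (r i) - t0)" for i
    by (simp add: \<theta>0 \<theta>r inner_vec_def sum_divide_distrib)
  ultimately have "(\<lambda>i. (a \<bullet> (\<theta> (\<tau> (r i)) - \<theta> t0)) / (\<tau> (r i) - t0)) \<longlonglongrightarrow> a \<bullet> c"
    by (simp add: inner_vec_def)
  then have "B + \<epsilon> \<le> a \<bullet> c"
    by (rule LIMSEQ_le_const) (use \<tau>(3) in blast)
  moreover have "a \<bullet> c \<le> B"
    unfolding c_def
    by (rule angle_velocity_le[OF orthonormal_frame_base[OF frame0] m(1) n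
          orthonormal_frame_normal[OF frame0] \<psi> B])
  ultimately show False using \<open>0 < \<epsilon>\<close> by simp
qed

section \<open>Integration along the geodesic and separation from the hull\<close>

lemma jordan_angles_support_bound:
  fixes L M N :: "(real^'n) set" and a :: "real^('p::{finite,linorder})"
  assumes pq: "CARD('p) \<le> CARD('n) - CARD('p)"
    and L: "subspace L" "dim L = CARD('p)" and M: "subspace M" "dim M = CARD('p)"
    and N: "subspace N" "dim N = CARD('p)"
    and B: "\<And>z. z \<in> Wp_orbit (jordan_angles M N) \<Longrightarrow> a \<bullet> z \<le> B"
  shows "a \<bullet> (jordan_angles L N - jordan_angles L M) \<le> B"
proof -
  obtain e v :: "real^'n^('p::{finite,linorder})" and \<psi> where frame: "angle_frame M N e v \<psi>"
    by (rule angle_frame_exists[OF pq M N])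
  have \<psi>_eq: "jordan_angles M N = \<psi>" by (rule angle_frame_jordan_angles[OF frame M N])
  note ev = frame_orthonormal[OF frame]
  have \<psi>: "0 \<le> \<psi>$i" "i \<le> j \<Longrightarrow> \<psi>$i \<le> \<psi>$j" for i j
    using frame by (auto simp: angle_frame_def)
  define m where "m t = combine (\<lambda>k. cos (t * \<psi>$k)) (\<lambda>k. sin (t * \<psi>$k)) e v" for t
  define n where "n t = combine (\<lambda>k. - sin (t * \<psi>$k)) (\<lambda>k. cos (t * \<psi>$k)) e v" for t
  have m: "orthonormal (m t)" and n: "orthonormal (n t)" for t
    unfolding m_def n_def by (intro orthonormal_combine ev; simp)+
  have cont: "isCont m t" for t
    unfolding isCont_def by (rule vec_tendstoI) (auto simp: m_def intro!: tendsto_intros)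
  have quot: "((\<lambda>t. (m t $ k - m t0 $ k) /\<^sub>R (t - t0)) \<longlongrightarrow> \<psi>$k *\<^sub>R n t0 $ k) (at t0)" for t0 k
  proof -
    have "((\<lambda>t. cos (t * \<psi>$k)) has_real_derivative - (\<psi>$k * sin (t0 * \<psi>$k))) (at t0)"
      "((\<lambda>t. sin (t * \<psi>$k)) has_real_derivative \<psi>$k * cos (t0 * \<psi>$k)) (at t0)"
      by (auto intro!: derivative_eq_intros)
    then have "((\<lambda>t. ((cos (t * \<psi>$k) - cos (t0 * \<psi>$k)) / (t - t0)) *\<^sub>R e$k
      + ((sin (t * \<psi>$k) - sin (t0 * \<psi>$k)) / (t - t0)) *\<^sub>R v$k) \<longlongrightarrow>
      (- (\<psi>$k * sin (t0 * \<psi>$k))) *\<^sub>R e$k + (\<psi>$k * cos (t0 * \<psi>$k)) *\<^sub>R v$k) (at t0)"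
      unfolding has_field_derivative_iff by (intro tendsto_intros)
    moreover have "(- (\<psi>$k * sin (t0 * \<psi>$k))) *\<^sub>R e$k + (\<psi>$k * cos (t0 * \<psi>$k)) *\<^sub>R v$k = \<psi>$k *\<^sub>R n t0 $ k"
      by (simp add: n_def algebra_simps)
    moreover have "((cos (t * \<psi>$k) - cos (t0 * \<psi>$k)) / (t - t0)) *\<^sub>R e$k
      + ((sin (t * \<psi>$k) - sin (t0 * \<psi>$k)) / (t - t0)) *\<^sub>R v$k = (m t $ k - m t0 $ k) /\<^sub>R (t - t0)" for t
      by (simp add: m_def divide_inverse algebra_simps)
    ultimately show ?thesis by simp
  qed
  define \<theta> :: "real \<Rightarrow> real^('p::{finite,linorder})"
    where "\<theta> t = jordan_angles L (span (range (\<lambda>k. m t $ k)))" for t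
  have "m 0 $ k \<in> M" for k using frame by (simp add: m_def angle_frame_def)
  then have \<theta>_0: "\<theta> 0 = jordan_angles L M"
    unfolding \<theta>_def by (simp add: orthonormal_span[OF m M])
  have "m 1 $ k \<in> N" for k using frame by (simp add: m_def angle_frame_def)
  then have \<theta>_1: "\<theta> 1 = jordan_angles L N"
    unfolding \<theta>_def by (simp add: orthonormal_span[OF m N])
  have "a \<bullet> (\<theta> 1 - \<theta> 0) \<le> B + \<epsilon>" if eps: "0 < \<epsilon>" for \<epsilon>
  proof -
    have "a \<bullet> (\<theta> 1 - \<theta> 0) \<le> (B + \<epsilon>) * (1 - 0)"
    \<comment> \<open>Bisection replaces the mean value theorem: the bound is additive over adjacent
      intervals, so it suffices to have it on all short intervals around each point.\<close>
    proof (rule Bolzano[where P = "\<lambda>s t. a \<bullet> (\<theta> t - \<theta> s) \<le> (B + \<epsilon>) * (t - s)"])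
      fix t0 :: real
      obtain d where d: "0 < d" "\<And>t. t \<noteq> t0 \<Longrightarrow> \<bar>t - t0\<bar> < d \<Longrightarrow> (a \<bullet> (\<theta> t - \<theta> t0)) / (t - t0) < B + \<epsilon>"
        using jordan_angles_local_bound[OF pq L m cont n quot \<psi> B[unfolded \<psi>_eq] eps] unfolding \<theta>_def by blast
      have "a \<bullet> (\<theta> t - \<theta> s) \<le> (B + \<epsilon>) * (t - s)" if st: "s \<le> t0" "t0 \<le> t" "t - s < d" for s t
      proof -
        have 1: "a \<bullet> (\<theta> t - \<theta> t0) \<le> (B + \<epsilon>) * (t - t0)"
          using d(2)[of t] st by (cases "t = t0") (auto simp: divide_less_eq split: if_splits)
        \<comment> \<open>For \<open>s\<close> before \<open>t0\<close> the denominator is negative,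
          which turns the quotient bound into one on
          \<open>\<theta> t0 - \<theta> s\<close>.\<close>
        have 2: "a \<bullet> (\<theta> t0 - \<theta> s) \<le> (B + \<epsilon>) * (t0 - s)"
          using d(2)[of s] st by (cases "s = t0") (auto simp: divide_less_eq inner_diff_right algebra_simps split: if_splits)
        show ?thesis using 1 2 by (simp add: inner_diff_right algebra_simps)
      qed
      then show "\<exists>d>0. \<forall>s t. s \<le> t0 \<and> t0 \<le> t \<and> t - s < d \<longrightarrow> a \<bullet> (\<theta> t - \<theta> s) \<le> (B + \<epsilon>) * (t - s)"
        using d(1) by blast
    qed (simp_all add: inner_diff_right algebra_simps)
    then show ?thesis by simp
  qed
  then show ?thesis unfolding \<theta>_0[symmetric] \<theta>_1[symmetric] by (rule field_le_epsilon)
qed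

lemma jordan_angles_diff_in_hull:
  fixes L M N :: "(real^'n) set"
  assumes pq: "CARD('p::{finite,linorder}) \<le> CARD('n) - CARD('p)"
    and L: "subspace L" "dim L = CARD('p)" and M: "subspace M" "dim M = CARD('p)"
    and N: "subspace N" "dim N = CARD('p)"
  shows "jordan_angles L N - jordan_angles L M \<in>
    convex hull (Wp_orbit (jordan_angles M N :: real^('p::{finite,linorder})))" (is "?z \<in> ?H")
proof (rule ccontr)
  assume "?z \<notin> ?H"
  moreover have "closed ?H"
    by (simp add: compact_imp_closed finite_imp_compact_convex_hull finite_Wp_orbit)
  ultimately obtain a b where ab: "a \<bullet> ?z < b" "\<And>z. z \<in> ?H \<Longrightarrow> b < a \<bullet> z"
    using separating_hyperplane_closed_point[OF convex_convex_hull] by blast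
  \<comment> \<open>The separating hyperplane has the hull on its upper side, so the support bound
    is applied to \<open>- a\<close> with level \<open>- b\<close>.\<close>
  have "- a \<bullet> ?z \<le> - b"
    by (rule jordan_angles_support_bound[OF pq L M N]) (use ab(2) hull_inc in \<open>fastforce intro: less_imp_le\<close>)
  then show False using ab(1) by simp
qed

theorem theoremB:
  fixes L M N :: "(real^'n) set"
  assumes pq: "CARD('p::{finite,linorder}) \<le> CARD('n) - CARD('p::{finite,linorder})"
    and L: "L \<in> Gr TYPE('p::{finite,linorder})" and M: "M \<in> Gr TYPE('p::{finite,linorder})"
    and N: "N \<in> Gr TYPE('p::{finite,linorder})"
  shows "\<exists>\<theta>0 \<in> (\<lambda>z. (jordan_angles L M :: real^('p::{finite,linorder})) + z) `
             (convex hull (Wp_orbit (jordan_angles M N :: real^('p::{finite,linorder})))).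
           \<exists>\<sigma>. \<sigma> permutes (UNIV::('p::{finite,linorder}) set) \<and>
               (\<forall>j. cos (\<theta>0$j) = cos ((jordan_angles L N :: real^('p::{finite,linorder}))$(\<sigma> j)))"
proof (intro bexI exI conjI allI)
  have G: "subspace K" "dim K = CARD('p)" if "K \<in> Gr TYPE('p)" for K :: "(real^'n) set"
    using that by (auto simp: Gr_def)
  have "jordan_angles L N - jordan_angles L M \<in>
    convex hull (Wp_orbit (jordan_angles M N :: real^('p::{finite,linorder})))"
    by (rule jordan_angles_diff_in_hull[OF pq G(1)[OF L] G(2)[OF L] G(1)[OF M] G(2)[OF M] G(1)[OF N] G(2)[OF N]])
  \<comment> \<open>The angle vector of \<open>L\<close> and \<open>N\<close> itself lies in the
    translated hull, so the permutation can be \<open>id\<close>.\<close>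
  then show "jordan_angles L N \<in> (\<lambda>z. jordan_angles L M + z) `
      (convex hull (Wp_orbit (jordan_angles M N :: real^('p::{finite,linorder}))))"
    by (intro image_eqI[where x = "jordan_angles L N - jordan_angles L M"]) simp_all
  show "id permutes (UNIV :: 'p set)" by (rule permutes_id)
  show "cos (jordan_angles L N $ j) = cos (jordan_angles L N $ id j)" for j by simp
qed

end
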